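(* Let $q$ and $n$ be positive integers with $q>n$, and let $\varepsilon>0$. Let $g_0,\ldots,g_n:\mathbb{R}\to\mathbb{R}$ be tropical entire functions with no root common to all of them, linearly independent in the Gondran-Minoux sense. Let $f_0,\ldots,f_q$ be $q+1$ tropical linear combinations of $g_0,\ldots,g_n$ over $\mathbb{R}_{\max}$, $$f_k(x)=a_{0k}\odot g_0(x)\oplus a_{1k}\odot g_1(x)\oplus\cdots\oplus a_{nk}\odot g_n(x)=\max_{0\le i\le n}\{a_{ik}+g_i(x)\},\qquad 0\le k\le q .$$ Let $\lambda=\mathrm{ddg}(\{f_{n+1},\ldots,f_q\})$ be the degree of degeneracy, and let $$L=\bigl(f_0\odot f_1\odot\cdots\odot f_q\bigr)\oslash C_\circ(f_0,f_1,\ldots,f_n)=\sum_{k=0}^q f_k-C_\circ(f_0,\ldots,f_n).$$ Let $g=[g_0:\cdots:g_n]$ be the tropical holomorphic curve of $\mathbb{R}$ into $\mathbb{TP}^n$ with reduced representation $\mathbf{g}=(g_0,\ldots,g_n)$, and let $T_g(r)$ be its tropical Cartan characteristic function. If the hyper-order $\varsigma:=\varsigma(\mathbf{g})$ satisfies $\varsigma<1$, then $$(q-n-\lambda)\,T_g(r)\le N(r,1_\circ\oslash L)-N(r,L)+o\!\left(\frac{T_g(r)}{r^{1-\varsigma-\varepsilon}}\right),$$ where $r$ approaches infinity outside an exceptional set of finite logarithmic measure.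
   Context: Tropical arithmetic: $\mathbb{R}_{\max}=\mathbb{R}\cup\{-\infty\}$, $0_\circ=-\infty$, $1_\circ=0$, $a\oplus b=\max\{a,b\}$, $a\odot b=a+b$, $a\oslash b=a-b$ (for $b\neq 0_\circ$); operations on functions are pointwise. A tropical meromorphic function is a continuous piecewise linear function $f:\mathbb{R}\to\mathbb{R}$ (real slopes; the points where the slope changes form a discrete set with no finite limit points). Put $\omega_f(x)=\lim_{\varepsilon\to0+}(f'(x+\varepsilon)-f'(x-\varepsilon))$. A point $x$ is a pole of $f$ if $\omega_f(x)<0$ and a root if $\omega_f(x)>0$, with multiplicity $|\omega_f(x)|$. A tropical entire function is a tropical meromorphic function without poles (equivalently, a convex one). Counting function: $n(t,f)=\sum_{|s|\le t,\ \omega_f(s)<0}|\omega_f(s)|$ and $N(r,f)=\frac12\int_0^r n(t,f)\,dt$. Thus $N(r,1_\circ\oslash f)=N(r,-f)$ counts the roots of $f$. Gondran-Minoux independence: $g_0,\ldots,g_n$ are linearly dependent in the Gondran-Minoux sense if there exist disjoint $I,J$ with $I\cup J=\{0,\ldots,n\}$ and constants $\alpha_0,\ldots,\alpha_n\in\mathbb{R}_{\max}$, not all $-\infty$, such that $\max_{i\in I}\{\alpha_i+g_i\}=\max_{j\in J}\{\alpha_j+g_j\}$ identically (an empty maximum being $-\infty$); otherwise they are linearly independent. Tropical linear combination of $g_0,\ldots,g_n$ over $\mathbb{R}_{\max}$: a function $\max_{0\le i\le n}\{a_i+g_i\}$ with $a_i\in\mathbb{R}_{\max}$, at least one $a_i$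 being real. For such an $f$, let $\ell(f)$ be the least $j\in\{1,\ldots,n+1\}$ such that $f=\max_{1\le i\le j}\{a_{k_i}+g_{k_i}\}$ for some indices $0\le k_1<\cdots<k_j\le n$ and real $a_{k_i}$. The degree of degeneracy $\mathrm{ddg}(\{f_{n+1},\ldots,f_q\})$ is the number of indices $\nu\in\{n+1,\ldots,q\}$ with $\ell(f_\nu)<n+1$. Tropical Casoratian (shift step $1$): $C_\circ(f_0,\ldots,f_n)(x)=\max_\pi\sum_{j=0}^n f_j(x+\pi(j))$, the maximum being over all permutations $\pi$ of $\{0,\ldots,n\}$. Tropical projective space: $\mathbb{TP}^n$ is the quotient of $\mathbb{R}_{\max}^{n+1}\setminus\{(-\infty,\ldots,-\infty)\}$ by $(a_0,\ldots,a_n)\sim(\lambda+a_0,\ldots,\lambda+a_n)$, $\lambda\in\mathbb{R}$. A tropical holomorphic curve is a map $g=[g_0:\cdots:g_n]:\mathbb{R}\to\mathbb{TP}^n$ with $g_j$ tropical entire having no root common to all of them; $(g_0,\ldots,g_n)$ is then a reduced representation of $g$. Tropical Cartan characteristic: $T_g(r)=\frac12(F(r)+F(-r))-F(0)$, where $F(x)=\max\{g_0(x),\ldots,g_n(x)\}$. Hyper-order: $\varsigma(\mathbf{g})=\limsup_{r\to\infty}\frac{\log\log T_g(r)}{\log r}$. A set $E\subset[0,\infty)$ has finite logarithmic measure if $\int_{E\cap[1,\infty)}dr/r<\infty$. *)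

theory Defs
  imports "HOL-Analysis.Analysis" "HOL-Combinatorics.Permutations" "HOL-Library.Landau_Symbols"
begin

text \<open>The tropical semiring is the extended reals without \<open>\<infinity>\<close>. Tropical addition is \<open>max\<close> and
  tropical multiplication is \<open>+\<close>, which is unproblematic on \<open>ereal\<close> because \<open>\<infinity>\<close> is excluded.\<close>

definition Rmax :: "ereal set" where
  "Rmax = UNIV - {\<infinity>}"

text \<open>\<open>S\<close> contains the points where the slope changes; it has no finite limit point.\<close>

definition trop_meromorphic :: "(real \<Rightarrow> real) \<Rightarrow> bool" where
  "trop_meromorphic f \<longleftrightarrow>
     continuous_on UNIV f \<and>
     (\<exists>S. (\<forall>x. \<not> x islimpt S) \<and>
          (\<forall>a b. a < b \<longrightarrow> {a<..<b} \<inter> S = {} \<longrightarrow>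
             (\<exists>m c. \<forall>x\<in>{a<..<b}. f x = m * x + c)))"

definition omega :: "(real \<Rightarrow> real) \<Rightarrow> real \<Rightarrow> real" where
  "omega f x = Lim (at_right 0) (\<lambda>\<epsilon>. deriv f (x + \<epsilon>) - deriv f (x - \<epsilon>))"

definition trop_pole :: "(real \<Rightarrow> real) \<Rightarrow> real \<Rightarrow> bool" where
  "trop_pole f x \<longleftrightarrow> omega f x < 0"

definition trop_root :: "(real \<Rightarrow> real) \<Rightarrow> real \<Rightarrow> bool" where
  "trop_root f x \<longleftrightarrow> omega f x > 0"

definition trop_entire :: "(real \<Rightarrow> real) \<Rightarrow> bool" where
  "trop_entire f \<longleftrightarrow> trop_meromorphic f \<and> (\<forall>x. \<not> trop_pole f x)"

text \<open>For a tropical meromorphic \<open>f\<close> the sum is over a finite set, since the points where the slope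
  changes do not accumulate.\<close>

definition trop_n :: "real \<Rightarrow> (real \<Rightarrow> real) \<Rightarrow> real" where
  "trop_n t f = (\<Sum>s | \<bar>s\<bar> \<le> t \<and> trop_pole f s. \<bar>omega f s\<bar>)"

definition trop_N :: "real \<Rightarrow> (real \<Rightarrow> real) \<Rightarrow> real" where
  "trop_N r f = 1 / 2 * integral {0..r} (\<lambda>t. trop_n t f)"

text \<open>The supremum of the empty set in \<open>ereal\<close> is \<open>-\<infinity>\<close>, which is the convention for empty maxima.\<close>

definition trop_comb :: "nat set \<Rightarrow> (nat \<Rightarrow> ereal) \<Rightarrow> (nat \<Rightarrow> real \<Rightarrow> real) \<Rightarrow> real \<Rightarrow> ereal" where
  "trop_comb I a g x = (SUP i\<in>I. a i + ereal (g i x))"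

definition GM_dependent :: "nat \<Rightarrow> (nat \<Rightarrow> real \<Rightarrow> real) \<Rightarrow> bool" where
  "GM_dependent n g \<longleftrightarrow>
     (\<exists>I J \<alpha>. I \<inter> J = {} \<and> I \<union> J = {0..n} \<and>
        (\<forall>i\<in>{0..n}. \<alpha> i \<in> Rmax) \<and> (\<exists>i\<in>{0..n}. \<alpha> i \<noteq> -\<infinity>) \<and>
        (\<forall>x. trop_comb I \<alpha> g x = trop_comb J \<alpha> g x))"

definition trop_lin_comb_of ::
    "nat \<Rightarrow> (nat \<Rightarrow> real \<Rightarrow> real) \<Rightarrow> (nat \<Rightarrow> ereal) \<Rightarrow> (real \<Rightarrow> real) \<Rightarrow> bool" where
  "trop_lin_comb_of n g a f \<longleftrightarrow>
     (\<forall>i\<in>{0..n}. a i \<in> Rmax) \<and> (\<exists>i\<in>{0..n}. a i \<noteq> -\<infinity>) \<and>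
     (\<forall>x. ereal (f x) = trop_comb {0..n} a g x)"

text \<open>The index set \<open>K = {k\<^sub>1, \<dots>, k\<^sub>j}\<close> stands for the increasing sequence of indices.\<close>

definition trop_length :: "nat \<Rightarrow> (nat \<Rightarrow> real \<Rightarrow> real) \<Rightarrow> (real \<Rightarrow> real) \<Rightarrow> nat" where
  "trop_length n g f =
     (LEAST j. j \<in> {1..n + 1} \<and>
        (\<exists>K (a :: nat \<Rightarrow> real). K \<subseteq> {0..n} \<and> card K = j \<and>
           (\<forall>x. f x = Max ((\<lambda>i. a i + g i x) ` K))))"

definition ddg ::
    "nat \<Rightarrow> (nat \<Rightarrow> real \<Rightarrow> real) \<Rightarrow> nat \<Rightarrow> nat \<Rightarrow> (nat \<Rightarrow> real \<Rightarrow> real) \<Rightarrow> nat" where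
  "ddg n g m q f = card {\<nu> \<in> {m..q}. trop_length n g (f \<nu>) < n + 1}"

definition trop_casoratian :: "nat \<Rightarrow> (nat \<Rightarrow> real \<Rightarrow> real) \<Rightarrow> real \<Rightarrow> real" where
  "trop_casoratian n f x =
     Max ((\<lambda>\<pi>. \<Sum>j = 0..n. f j (x + real (\<pi> j))) ` {\<pi>. \<pi> permutes {0..n}})"

definition trop_tuples :: "nat \<Rightarrow> (nat \<Rightarrow> ereal) set" where
  "trop_tuples n = {a \<in> {0..n} \<rightarrow>\<^sub>E Rmax. \<exists>i\<in>{0..n}. a i \<noteq> -\<infinity>}"

definition trop_proj_rel :: "nat \<Rightarrow> ((nat \<Rightarrow> ereal) \<times> (nat \<Rightarrow> ereal)) set" where
  "trop_proj_rel n =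
     {(a, b). a \<in> trop_tuples n \<and> b \<in> trop_tuples n \<and>
              (\<exists>c :: real. \<forall>i\<in>{0..n}. b i = ereal c + a i)}"

definition trop_proj_space :: "nat \<Rightarrow> (nat \<Rightarrow> ereal) set set" where
  "trop_proj_space n = trop_tuples n // trop_proj_rel n"

definition trop_proj_point :: "nat \<Rightarrow> (nat \<Rightarrow> ereal) \<Rightarrow> (nat \<Rightarrow> ereal) set" where
  "trop_proj_point n a = trop_proj_rel n `` {restrict a {0..n}}"

definition reduced_representation ::
    "nat \<Rightarrow> (real \<Rightarrow> (nat \<Rightarrow> ereal) set) \<Rightarrow> (nat \<Rightarrow> real \<Rightarrow> real) \<Rightarrow> bool" where
  "reduced_representation n G g \<longleftrightarrow>
     G \<in> UNIV \<rightarrow> trop_proj_space n \<and>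
     (\<forall>x. G x = trop_proj_point n (\<lambda>j. ereal (g j x))) \<and>
     (\<forall>j\<in>{0..n}. trop_entire (g j)) \<and>
     \<not> (\<exists>x. \<forall>j\<in>{0..n}. trop_root (g j) x)"

text \<open>The characteristic of a curve is computed from a reduced representation of it. Two reduced
  representations of the same curve differ by an affine function, which does not affect the value.\<close>

definition trop_cartan :: "nat \<Rightarrow> (nat \<Rightarrow> real \<Rightarrow> real) \<Rightarrow> real \<Rightarrow> real" where
  "trop_cartan n g r =
     (let F = (\<lambda>x. Max ((\<lambda>j. g j x) ` {0..n})) in (F r + F (- r)) / 2 - F 0)"

text \<open>The values of \<open>ln\<close> at nonpositive arguments play no role: when the \<open>g j\<close> are tropical entire and
  independent and \<open>n > 0\<close>, the characteristic is bounded below by a positive multiple of \<open>r\<close>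
  for large \<open>r\<close>. In that case the hyper-order is also nonnegative.\<close>

definition hyper_order :: "nat \<Rightarrow> (nat \<Rightarrow> real \<Rightarrow> real) \<Rightarrow> ereal" where
  "hyper_order n g = Limsup at_top (\<lambda>r. ereal (ln (ln (trop_cartan n g r)) / ln r))"

definition finite_log_measure :: "real set \<Rightarrow> bool" where
  "finite_log_measure E \<longleftrightarrow>
     E \<subseteq> {0..} \<and> E \<in> sets lebesgue \<and>
     (\<integral>\<^sup>+ r \<in> E \<inter> {1..}. ennreal (1 / r) \<partial>lebesgue) < \<infinity>"

definition at_top_outside :: "real set \<Rightarrow> real filter" where
  "at_top_outside E = inf at_top (principal (- E))"

end

theory Submission
  imports Defs
begin

text \<open>
  By Jensen's formula (\<open>tropical_Jensen\<close>) the difference of the counting functions of \<open>L\<close> equals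
  \<open>(L r + L (- r)) / 2 - L 0\<close>, so it suffices to bound the symmetric mean of \<open>L\<close> from below. Write
  \<open>F\<close> for the maximum of the \<open>g j\<close> and \<open>T\<close> for the characteristic, which is the symmetric mean of \<open>F\<close> minus
  \<open>F 0\<close>, and split \<open>L\<close> into the sum of the \<open>f k\<close> with \<open>k > n\<close> and the difference between the sum of the \<open>f j\<close> with
  \<open>j \<le> n\<close> and the Casoratian.

  All functions in sight except \<open>L\<close> are convex, because tropical entire functions are
  (\<open>trop_entire_imp_convex\<close>). A combination \<open>f k\<close> that is not degenerate has only real coefficients, so
  \<open>f k \<ge> F - c\<close> and its symmetric mean is at least \<open>T r - O(1)\<close>; for a degenerate one convexity gives the lower
  bound \<open>f k 0\<close> (\<open>proximity_lower_bound\<close>). This produces the factor \<open>q - n - \<lambda>\<close>.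

  The Casoratian exceeds the sum of the \<open>f j\<close> by at most a sum of increments \<open>f j (x + p) - f j x\<close> with \<open>0 \<le> p \<le> n\<close>. By
  convexity such increments are bounded at \<open>x = - r\<close>, and at \<open>x = r\<close> they are \<open>O(T (r + h) / h)\<close> for every \<open>h \<ge> n\<close>
  (\<open>casoratian_error\<close>). Take \<open>h = r powr \<alpha>\<close> with \<open>\<alpha>\<close> slightly smaller than one minus the hyper-order. Then
  \<open>T (r + h) \<le> 2 * T r\<close> outside a set of finite logarithmic measure
  (\<open>doubling_outside_finite_log_measure\<close>), so that the error is \<open>O(T r / r powr \<alpha>)\<close>. The remaining constants
  are of this order too, because independence of the \<open>g j\<close> forces \<open>T\<close> to grow at least linearly
  (\<open>T_linear_growth\<close>).
\<close>

section \<open>Piecewise affine functions\<close>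

text \<open>Because the condition concerns one point only, closure under sums, maxima and shifts can be checked
  pointwise, whereas the set of break points in the definition of tropical meromorphy would have to be
  rebuilt for every operation.\<close>

definition corner :: "(real \<Rightarrow> real) \<Rightarrow> real \<Rightarrow> real \<Rightarrow> real \<Rightarrow> bool" where
  "corner f x m m' \<longleftrightarrow>
     (\<forall>\<^sub>F y in at_left x. f y = f x + m * (y - x)) \<and>
     (\<forall>\<^sub>F y in at_right x. f y = f x + m' * (y - x))"

definition piecewise_affine :: "(real \<Rightarrow> real) \<Rightarrow> bool" where
  "piecewise_affine f \<longleftrightarrow> (\<forall>x. \<exists>m m'. corner f x m m')"

lemma corner_iff_radius:
  "corner f x m m' \<longleftrightarrow>
     (\<exists>d>0. \<forall>y. (x - d < y \<and> y \<le> x \<longrightarrow> f y = f x + m * (y - x)) \<and>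
                 (x \<le> y \<and> y < x + d \<longrightarrow> f y = f x + m' * (y - x)))"
  (is "_ \<longleftrightarrow> ?R")
proof
  assume "corner f x m m'"
  then obtain a b where a: "a < x" "\<And>y. a < y \<Longrightarrow> y < x \<Longrightarrow> f y = f x + m * (y - x)"
    and b: "b > x" "\<And>y. x < y \<Longrightarrow> y < b \<Longrightarrow> f y = f x + m' * (y - x)"
    unfolding corner_def eventually_at_left_field eventually_at_right_field by blast
  show ?R
  proof (intro exI[of _ "min (x - a) (b - x)"] conjI allI impI)
    fix y assume "x - min (x - a) (b - x) < y \<and> y \<le> x"
    then show "f y = f x + m * (y - x)" using a(2)[of y] by (cases "y = x") auto
  next
    fix y assume "x \<le> y \<and> y < x + min (x - a) (b - x)"
    then show "f y = f x + m' * (y - x)" using b(2)[of y] by (cases "y = x") auto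
  qed (use a b in auto)
next
  assume ?R
  then obtain d where d: "d > 0" "\<And>y. x - d < y \<Longrightarrow> y \<le> x \<Longrightarrow> f y = f x + m * (y - x)"
    "\<And>y. x \<le> y \<Longrightarrow> y < x + d \<Longrightarrow> f y = f x + m' * (y - x)" by blast
  show "corner f x m m'"
    unfolding corner_def eventually_at_left_field eventually_at_right_field
    using d(1) by (intro conjI exI[of _ "x - d"] exI[of _ "x + d"] allI impI d(2,3)) auto
qed

lemma corner_tendsto:
  assumes "corner f x m m'"
  shows "(f \<longlongrightarrow> f x) (at_left x)" "(f \<longlongrightarrow> f x) (at_right x)"
proof -
  have "((\<lambda>y. f x + m * (y - x)) \<longlongrightarrow> f x + m * (x - x)) (at_left x)"
    "((\<lambda>y. f x + m' * (y - x)) \<longlongrightarrow> f x + m' * (x - x)) (at_right x)"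
    by (intro tendsto_intros)+
  then show "(f \<longlongrightarrow> f x) (at_left x)" "(f \<longlongrightarrow> f x) (at_right x)"
    using assms unfolding corner_def by (auto elim!: Lim_transform_eventually elim: eventually_mono)
qed

lemma corner_isCont: "corner f x m m' \<Longrightarrow> isCont f x"
  using corner_tendsto by (metis filterlim_split_at isCont_def)

lemma corner_add:
  assumes "corner f x m m'" "corner g x k k'"
  shows "corner (\<lambda>y. f y + g y) x (m + k) (m' + k')"
proof -
  have l: "\<forall>\<^sub>F y in at_left x. f y = f x + m * (y - x)" "\<forall>\<^sub>F y in at_left x. g y = g x + k * (y - x)"
    and r: "\<forall>\<^sub>F y in at_right x. f y = f x + m' * (y - x)" "\<forall>\<^sub>F y in at_right x. g y = g x + k' * (y - x)"
    using assms by (auto simp: corner_def)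
  show ?thesis
    unfolding corner_def
  proof
    show "\<forall>\<^sub>F y in at_left x. f y + g y = f x + g x + (m + k) * (y - x)"
      using l by eventually_elim (simp add: distrib_right)
    show "\<forall>\<^sub>F y in at_right x. f y + g y = f x + g x + (m' + k') * (y - x)"
      using r by eventually_elim (simp add: distrib_right)
  qed
qed

lemma corner_minus:
  assumes "corner f x m m'"
  shows "corner (\<lambda>y. - f y) x (- m) (- m')"
  using assms unfolding corner_def by (auto elim!: eventually_mono)

lemma corner_shift:
  assumes "corner f (x + c) m m'"
  shows "corner (\<lambda>y. f (y + c)) x m m'"
proof -
  obtain d where d: "d > 0" "\<And>y. x + c - d < y \<Longrightarrow> y \<le> x + c \<Longrightarrow> f y = f (x + c) + m * (y - (x + c))"
    "\<And>y. x + c \<le> y \<Longrightarrow> y < x + c + d \<Longrightarrow> f y = f (x + c) + m' * (y - (x + c))"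
    using assms unfolding corner_iff_radius by blast
  show ?thesis
    unfolding corner_iff_radius
  proof (intro exI[of _ d] conjI allI impI d(1))
    fix y assume "x - d < y \<and> y \<le> x"
    then show "f (y + c) = f (x + c) + m * (y - x)" by (subst d(2)) auto
  next
    fix y assume "x \<le> y \<and> y < x + d"
    then show "f (y + c) = f (x + c) + m' * (y - x)" by (subst d(3)) auto
  qed
qed

text \<open>Where one function is strictly larger it alone determines the corner, by continuity. Where the
  values agree, the maximum takes the smaller slope on the left and the larger one on the right.\<close>

lemma corner_max:
  assumes f: "corner f x m m'" and g: "corner g x k k'"
  shows "\<exists>l l'. corner (\<lambda>y. max (f y) (g y)) x l l'"
proof -
  have dominated: "corner (\<lambda>y. max (u y) (v y)) x a a'"
    if u: "corner u x a a'" and v: "corner v x b b'" and less: "v x < u x" for u v a a' b b'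
  proof -
    have "((\<lambda>y. u y - v y) \<longlongrightarrow> u x - v x) (at_left x)"
         "((\<lambda>y. u y - v y) \<longlongrightarrow> u x - v x) (at_right x)"
      by (intro tendsto_intros corner_tendsto[OF u] corner_tendsto[OF v])+
    then have "\<forall>\<^sub>F y in at_left x. 0 < u y - v y" "\<forall>\<^sub>F y in at_right x. 0 < u y - v y"
      using less by (metis order_tendstoD(1) diff_gt_0_iff_gt)+
    moreover have "\<forall>\<^sub>F y in at_left x. u y = u x + a * (y - x)" "\<forall>\<^sub>F y in at_right x. u y = u x + a' * (y - x)"
      using u by (auto simp: corner_def)
    ultimately have "\<forall>\<^sub>F y in at_left x. max (u y) (v y) = u x + a * (y - x)"
      "\<forall>\<^sub>F y in at_right x. max (u y) (v y) = u x + a' * (y - x)"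
      by (smt (verit, best) eventually_elim2)+
    then show ?thesis
      using less unfolding corner_def by (simp add: max_def)
  qed
  consider "g x < f x" | "f x < g x" | "f x = g x" by linarith
  then show ?thesis
  proof cases
    case 1
    then show ?thesis using dominated[OF f g] by blast
  next
    case 2
    then show ?thesis using dominated[OF g f] by (auto simp: max.commute)
  next
    case 3
    have l: "max (c + m * (y - x)) (c + k * (y - x)) = c + min m k * (y - x)" if "y < x" for c y
      using that mult_right_mono_neg[of m k "y - x"] mult_right_mono_neg[of k m "y - x"]
      by (auto simp: max_def min_def)
    have r: "max (c + m' * (y - x)) (c + k' * (y - x)) = c + max m' k' * (y - x)" if "y > x" for c y
      using that mult_right_mono[of m' k' "y - x"] mult_right_mono[of k' m' "y - x"]
      by (auto simp: max_def)
    have le: "\<forall>\<^sub>F y in at_left x. y < x" "\<forall>\<^sub>F y in at_left x. f y = f x + m * (y - x)"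
      "\<forall>\<^sub>F y in at_left x. g y = g x + k * (y - x)"
      and re: "\<forall>\<^sub>F y in at_right x. y > x" "\<forall>\<^sub>F y in at_right x. f y = f x + m' * (y - x)"
      "\<forall>\<^sub>F y in at_right x. g y = g x + k' * (y - x)"
      using f g by (auto simp: corner_def eventually_at_filter)
    have "\<forall>\<^sub>F y in at_left x. max (f y) (g y) = f x + min m k * (y - x)"
      using le by eventually_elim (metis l 3)
    moreover have "\<forall>\<^sub>F y in at_right x. max (f y) (g y) = f x + max m' k' * (y - x)"
      using re by eventually_elim (metis r 3)
    ultimately have "corner (\<lambda>y. max (f y) (g y)) x (min m k) (max m' k')"
      unfolding corner_def using 3 by simp
    then show ?thesis by blast
  qed
qed

text \<open>Break points are isolated: close to \<open>x\<close>, on either side, the two slopes coincide.\<close>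

lemma corner_both_sides:
  assumes "corner f x m m'"
  shows "\<forall>\<^sub>F y in at_left x. corner f y m m" "\<forall>\<^sub>F y in at_right x. corner f y m' m'"
proof -
  obtain d where d: "d > 0" "\<And>y. x - d < y \<Longrightarrow> y \<le> x \<Longrightarrow> f y = f x + m * (y - x)"
    "\<And>y. x \<le> y \<Longrightarrow> y < x + d \<Longrightarrow> f y = f x + m' * (y - x)"
    using assms unfolding corner_iff_radius by blast
  have "corner f y m m" if y: "x - d < y" "y < x" for y
  proof -
    have local_affine: "f z = f y + m * (z - y)" if "x - d < z" "z \<le> x" for z
      using d(2)[of z] d(2)[of y] that y by (simp add: algebra_simps)
    show ?thesis
      unfolding corner_iff_radius
      by (intro exI[of _ "min (y - (x - d)) (x - y)"] conjI allI impI local_affine; use y in linarith)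
  qed
  then show "\<forall>\<^sub>F y in at_left x. corner f y m m"
    unfolding eventually_at_left_field using d(1) by (intro exI[of _ "x - d"]) auto
  have "corner f y m' m'" if y: "x < y" "y < x + d" for y
  proof -
    have local_affine: "f z = f y + m' * (z - y)" if "x \<le> z" "z < x + d" for z
      using d(3)[of z] d(3)[of y] that y by (simp add: algebra_simps)
    show ?thesis
      unfolding corner_iff_radius
      by (intro exI[of _ "min ((x + d) - y) (y - x)"] conjI allI impI local_affine; use y in linarith)
  qed
  then show "\<forall>\<^sub>F y in at_right x. corner f y m' m'"
    unfolding eventually_at_right_field using d(1) by (intro exI[of _ "x + d"]) auto
qed

lemma corner_DERIV:
  assumes "corner f x m m"
  shows "(f has_real_derivative m) (at x)"
proof -
  obtain d where d: "d > 0" "\<And>y. x - d < y \<Longrightarrow> y \<le> x \<Longrightarrow> f y = f x + m * (y - x)"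
    "\<And>y. x \<le> y \<Longrightarrow> y < x + d \<Longrightarrow> f y = f x + m * (y - x)"
    using assms unfolding corner_iff_radius by blast
  have "((\<lambda>y. f x + m * (y - x)) has_real_derivative m) (at x)"
    by (auto intro!: derivative_eq_intros)
  then show ?thesis
    by (rule has_field_derivative_transform_within_open[of _ _ _ "{x-d<..<x+d}"])
       (use d(1) d(2,3)[symmetric] in \<open>auto, metis linear\<close>)
qed

lemma corner_omega:
  assumes "corner f x m m'"
  shows "omega f x = m' - m"
proof -
  have "\<forall>\<^sub>F e in at_right 0. deriv f (x + e) = m'"
    using corner_both_sides(2)[OF assms] unfolding eventually_at_right_to_0[of _ x]
    by eventually_elim (simp add: DERIV_imp_deriv corner_DERIV add.commute)
  moreover have "\<forall>\<^sub>F e in at_right 0. deriv f (x - e) = m"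
  proof -
    obtain b where "b < x" "\<And>y. b < y \<Longrightarrow> y < x \<Longrightarrow> corner f y m m"
      using corner_both_sides(1)[OF assms] unfolding eventually_at_left_field by blast
    then show ?thesis
      unfolding eventually_at_right_field
      by (intro exI[of _ "x - b"]) (auto intro!: DERIV_imp_deriv corner_DERIV)
  qed
  ultimately have "\<forall>\<^sub>F e in at_right 0. deriv f (x + e) - deriv f (x - e) = m' - m"
    by eventually_elim simp
  then have "((\<lambda>e. deriv f (x + e) - deriv f (x - e)) \<longlongrightarrow> m' - m) (at_right 0)"
    by (rule tendsto_eventually)
  then show ?thesis
    unfolding omega_def by (intro tendsto_Lim) auto
qed

text \<open>As \<open>x\<close> is not a limit of break points, the function is affine on a punctured interval on each side;
  continuity makes both affine pieces take the value \<open>f x\<close> at \<open>x\<close>.\<close>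

lemma trop_meromorphic_imp_piecewise_affine:
  assumes "trop_meromorphic f"
  shows "piecewise_affine f"
  unfolding piecewise_affine_def
proof
  fix x
  obtain S where cont: "continuous_on UNIV f" and S: "\<And>x. \<not> x islimpt S"
    and aff: "\<And>a b. a < b \<Longrightarrow> {a<..<b} \<inter> S = {} \<Longrightarrow> \<exists>m c. \<forall>x\<in>{a<..<b}. f x = m * x + c"
    using assms unfolding trop_meromorphic_def by blast
  obtain d where d: "d > 0" "\<And>y. y \<in> S \<Longrightarrow> y \<noteq> x \<Longrightarrow> \<bar>y - x\<bar> \<ge> d"
    using S[of x] unfolding islimpt_approachable dist_real_def by (meson not_le)
  have disj: "{x-d<..<x} \<inter> S = {}" "{x<..<x+d} \<inter> S = {}"
    using d(2) by (force simp: abs_if split: if_splits)+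
  obtain m c where m: "\<And>y. y \<in> {x-d<..<x} \<Longrightarrow> f y = m * y + c"
    using aff[OF _ disj(1)] d(1) by auto
  obtain m' c' where m': "\<And>y. y \<in> {x<..<x+d} \<Longrightarrow> f y = m' * y + c'"
    using aff[OF _ disj(2)] d(1) by auto
  have ev: "\<forall>\<^sub>F y in at_left x. f y = m * y + c" "\<forall>\<^sub>F y in at_right x. f y = m' * y + c'"
    unfolding eventually_at_left_field eventually_at_right_field using d(1)
    by (intro exI[of _ "x - d"] exI[of _ "x + d"] conjI allI impI m m'; simp)+
  have "(f \<longlongrightarrow> f x) (at x)"
    using cont by (auto simp: continuous_on_def)
  then have lim: "(f \<longlongrightarrow> f x) (at_left x)" "(f \<longlongrightarrow> f x) (at_right x)"
    by (auto simp: filterlim_at_split)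
  have "((\<lambda>y. m * y + c) \<longlongrightarrow> f x) (at_left x)" "((\<lambda>y. m' * y + c') \<longlongrightarrow> f x) (at_right x)"
    using Lim_transform_eventually[OF lim(1) ev(1)] Lim_transform_eventually[OF lim(2) ev(2)] by auto
  moreover have "((\<lambda>y. m * y + c) \<longlongrightarrow> m * x + c) (at_left x)"
     "((\<lambda>y. m' * y + c') \<longlongrightarrow> m' * x + c') (at_right x)"
    by (intro tendsto_intros)+
  ultimately have "f x = m * x + c" "f x = m' * x + c'"
    using tendsto_unique[OF trivial_limit_at_left_real] tendsto_unique[OF trivial_limit_at_right_real]
    by blast+
  then have "corner f x m m'"
    using ev unfolding corner_def by (auto elim!: eventually_mono simp: algebra_simps)
  then show "\<exists>m m'. corner f x m m'" by blast
qed

lemma piecewise_affine_continuous: "piecewise_affine f \<Longrightarrow> continuous_on UNIV f"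
  by (meson UNIV_I continuous_at_imp_continuous_on corner_isCont piecewise_affine_def)

lemma piecewise_affine_add:
  "piecewise_affine f \<Longrightarrow> piecewise_affine g \<Longrightarrow> piecewise_affine (\<lambda>x. f x + g x)"
  unfolding piecewise_affine_def using corner_add by meson

lemma piecewise_affine_minus: "piecewise_affine f \<Longrightarrow> piecewise_affine (\<lambda>x. - f x)"
  unfolding piecewise_affine_def using corner_minus by meson

lemma piecewise_affine_shift: "piecewise_affine f \<Longrightarrow> piecewise_affine (\<lambda>x. f (x + c))"
  unfolding piecewise_affine_def using corner_shift by meson

lemma piecewise_affine_max:
  "piecewise_affine f \<Longrightarrow> piecewise_affine g \<Longrightarrow> piecewise_affine (\<lambda>x. max (f x) (g x))"
  unfolding piecewise_affine_def using corner_max by meson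

lemma piecewise_affine_const: "piecewise_affine (\<lambda>x. c)"
  unfolding piecewise_affine_def corner_def by (auto intro!: exI[of _ 0])

lemma piecewise_affine_sum:
  "(\<And>i. i \<in> A \<Longrightarrow> piecewise_affine (f i)) \<Longrightarrow> piecewise_affine (\<lambda>x. \<Sum>i\<in>A. f i x)"
  by (induction A rule: infinite_finite_induct)
     (simp_all add: piecewise_affine_const piecewise_affine_add)

lemma piecewise_affine_Max:
  assumes "finite A" "A \<noteq> {}" "\<And>i. i \<in> A \<Longrightarrow> piecewise_affine (f i)"
  shows "piecewise_affine (\<lambda>x. Max ((\<lambda>i. f i x) ` A))"
  using assms
proof (induction A rule: finite_ne_induct)
  case (insert i A)
  then have "(\<lambda>x. Max ((\<lambda>i. f i x) ` insert i A)) = (\<lambda>x. max (f i x) (Max ((\<lambda>i. f i x) ` A)))"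
    by simp
  with insert show ?case by (simp add: piecewise_affine_max)
qed simp

lemma omega_minus:
  assumes "piecewise_affine f"
  shows "omega (\<lambda>x. - f x) x = - omega f x"
  using assms corner_omega corner_minus unfolding piecewise_affine_def by (metis minus_diff_minus)

section \<open>Convexity of tropical entire functions\<close>

lemma trop_entire_corner:
  assumes "trop_entire f"
  shows "\<exists>m m'. m \<le> m' \<and> corner f x m m'"
proof -
  obtain m m' where c: "corner f x m m'"
    using assms trop_meromorphic_imp_piecewise_affine unfolding trop_entire_def piecewise_affine_def by blast
  moreover have "\<not> omega f x < 0"
    using assms by (simp add: trop_entire_def trop_pole_def)
  ultimately have "m \<le> m'" by (simp add: corner_omega[OF c])
  then show ?thesis using c by blast
qed

text \<open>If \<open>f\<close> exceeded a chord somewhere, the difference \<open>e\<close> would have a positive maximum inside the interval.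
  At the leftmost such maximum the right slope of \<open>e\<close> is at most \<open>0\<close>, hence so is the left slope, which is
  not larger. Then \<open>e\<close> does not decrease when moving to the left, so there is a maximum further left.\<close>

lemma trop_entire_imp_convex:
  assumes "trop_entire f"
  shows "convex_on UNIV f"
proof (rule convex_on_linorderI)
  fix t x y :: real assume t: "0 < t" "t < 1" and "x < y"
  define k where "k = (f y - f x) / (y - x)"
  define e where "e = (\<lambda>z. f z - (f x + k * (z - x)))"
  have "continuous_on UNIV f"
    using assms trop_meromorphic_def trop_entire_def by blast
  then have conte: "continuous_on {x..y} e"
    unfolding e_def by (intro continuous_intros) (auto intro: continuous_on_subset)
  have e0: "e x = 0" "e y = 0" using \<open>x < y\<close> by (auto simp: e_def k_def)
  have "e z \<le> 0" if z: "z \<in> {x..y}" for z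
  proof (rule ccontr)
    assume "\<not> e z \<le> 0"
    obtain p where p: "p \<in> {x..y}" "\<And>w. w \<in> {x..y} \<Longrightarrow> e w \<le> e p"
      using continuous_attains_sup[of "{x..y}" e] conte \<open>x < y\<close> by auto
    then have "e p > 0" using \<open>\<not> e z \<le> 0\<close> z by force
    define Z where "Z = {w \<in> {x..y}. e w = e p}"
    have "closed Z"
      unfolding Z_def by (rule continuous_closed_preimage_constant[OF conte]) auto
    moreover have "bounded Z" unfolding Z_def by (rule bounded_subset[of "{x..y}"]) auto
    ultimately have "compact Z" by (simp add: compact_eq_bounded_closed)
    moreover have "Z \<noteq> {}" using p by (auto simp: Z_def)
    ultimately obtain s where s: "s \<in> Z" "\<And>w. w \<in> Z \<Longrightarrow> s \<le> w"
      using compact_attains_inf[of Z] by (metis (no_types))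
    have es: "e s = e p" "x < s" "s < y"
    proof -
      have "e s = e p" "x \<le> s" "s \<le> y" using s(1) by (simp_all add: Z_def)
      moreover have "s \<noteq> x" "s \<noteq> y"
        using \<open>e s = e p\<close> \<open>e p > 0\<close> e0 by (metis less_irrefl)+
      ultimately show "e s = e p" "x < s" "s < y" by simp_all
    qed
    obtain m m' where mm: "m \<le> m'" "corner f s m m'" using trop_entire_corner[OF assms] by blast
    obtain d where d: "d > 0" "\<And>y. s - d < y \<Longrightarrow> y \<le> s \<Longrightarrow> f y = f s + m * (y - s)"
      "\<And>y. s \<le> y \<Longrightarrow> y < s + d \<Longrightarrow> f y = f s + m' * (y - s)"
      using mm(2) unfolding corner_iff_radius by blast
    define h where "h = min d (min (s - x) (y - s)) / 2"
    have h: "h > 0" "h < d" "s - h \<in> {x..y}" "s + h \<in> {x..y}"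
      using d(1) es unfolding h_def by (auto simp: min_def field_simps)
    have "e (s + h) = e s + (m' - k) * h"
      unfolding e_def using d(3)[of "s + h"] h by (simp add: algebra_simps)
    then have "(m' - k) * h \<le> 0" using p(2)[OF h(4)] es by simp
    then have "m' \<le> k" using h(1) by (simp add: mult_le_0_iff)
    have "e (s - h) = e s + (k - m) * h"
      unfolding e_def using d(2)[of "s - h"] h by (simp add: algebra_simps)
    then have "e (s - h) \<ge> e s" using \<open>m' \<le> k\<close> mm(1) h(1) by simp
    then have "s - h \<in> Z" using p(2)[OF h(3)] es(1) h(3) by (simp add: Z_def)
    then show False using s(2)[of "s - h"] h(1) by simp
  qed
  then have "e ((1 - t) * x + t * y) \<le> 0"
    using convexD_alt[of "{x..y}" x y t] \<open>x < y\<close> t by simp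
  moreover have "f x + k * ((1 - t) * x + t * y - x) = (1 - t) * f x + t * f y"
  proof -
    have "k * ((1 - t) * x + t * y - x) = t * (k * (y - x))" by (simp add: algebra_simps)
    also have "k * (y - x) = f y - f x" using \<open>x < y\<close> by (simp add: k_def)
    finally show ?thesis by (simp add: algebra_simps)
  qed
  ultimately show "f ((1 - t) *\<^sub>R x + t *\<^sub>R y) \<le> (1 - t) * f x + t * f y"
    by (simp add: e_def)
qed simp

section \<open>The tropical Jensen formula\<close>

definition left_slope :: "(real \<Rightarrow> real) \<Rightarrow> real \<Rightarrow> real" where
  "left_slope f x = (SOME m. \<exists>m'. corner f x m m')"

text \<open>With this choice the jump of the slope is \<open>omega\<close> by construction.\<close>

definition right_slope :: "(real \<Rightarrow> real) \<Rightarrow> real \<Rightarrow> real" where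
  "right_slope f x = left_slope f x + omega f x"

lemma corner_unique:
  assumes "corner f x m m'" "corner f x k k'"
  shows "m = k" "m' = k'"
proof -
  have "\<forall>\<^sub>F y in at_left x. y < x \<and> f y = f x + m * (y - x) \<and> f y = f x + k * (y - x)"
    using assms by (auto simp: corner_def eventually_conj_iff eventually_at_filter)
  then obtain y where "y < x" "m * (y - x) = k * (y - x)"
    using eventually_happens[of _ "at_left x"] trivial_limit_at_left_real by fastforce
  then show "m = k" by simp
  have "\<forall>\<^sub>F y in at_right x. x < y \<and> f y = f x + m' * (y - x) \<and> f y = f x + k' * (y - x)"
    using assms by (auto simp: corner_def eventually_conj_iff eventually_at_filter)
  then obtain y where "x < y" "m' * (y - x) = k' * (y - x)"
    using eventually_happens[of _ "at_right x"] trivial_limit_at_right_real by fastforce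
  then show "m' = k'" by simp
qed

lemma slopes_of_corner:
  assumes "corner f x m m'"
  shows "left_slope f x = m" "right_slope f x = m'"
proof -
  show "left_slope f x = m"
    unfolding left_slope_def using assms corner_unique(1) by (intro some_equality) blast+
  then show "right_slope f x = m'"
    by (simp add: right_slope_def corner_omega[OF assms])
qed

lemma piecewise_affine_corner:
  assumes "piecewise_affine f"
  shows "corner f x (left_slope f x) (right_slope f x)"
  using assms slopes_of_corner unfolding piecewise_affine_def by metis

lemma slopes_near:
  assumes "piecewise_affine f"
  shows "\<forall>\<^sub>F y in at_left x. omega f y = 0 \<and> right_slope f y = left_slope f x"
    and "\<forall>\<^sub>F y in at_right x. omega f y = 0 \<and> right_slope f y = right_slope f x"
proof -
  note c = corner_both_sides[OF piecewise_affine_corner[OF assms, of x]]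
  show "\<forall>\<^sub>F y in at_left x. omega f y = 0 \<and> right_slope f y = left_slope f x"
    using c(1) by eventually_elim (simp add: corner_omega slopes_of_corner)
  show "\<forall>\<^sub>F y in at_right x. omega f y = 0 \<and> right_slope f y = right_slope f x"
    using c(2) by eventually_elim (simp add: corner_omega slopes_of_corner)
qed

lemma finite_breakpoints:
  assumes "piecewise_affine f" "bounded A"
  shows "finite {s \<in> A. omega f s \<noteq> 0}"
proof -
  have "\<not> x islimpt {s. omega f s \<noteq> 0}" for x
  proof -
    have "\<forall>\<^sub>F y in at x. omega f y = 0"
      using slopes_near[OF assms(1), of x] by (auto simp: eventually_at_split elim: eventually_mono)
    then show ?thesis by (auto simp: islimpt_iff_eventually elim: eventually_mono)
  qed
  then have "finite (closure A \<inter> {s. omega f s \<noteq> 0})"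
    using assms(2) by (intro finite_not_islimpt_in_compact) (auto simp: compact_closure)
  then show ?thesis
    by (rule finite_subset[rotated]) (use closure_subset in auto)
qed

text \<open>The slope changes only at break points, by \<open>omega\<close>. Formally, the right slope minus the accumulated
  jumps is locally constant on the connected half-line starting at \<open>a\<close>.\<close>

lemma slope_increment:
  assumes f: "piecewise_affine f" and "a \<le> b"
  shows "right_slope f b - left_slope f a = (\<Sum>s | s \<in> {a..b} \<and> omega f s \<noteq> 0. omega f s)"
proof -
  define W where "W = (\<lambda>t. \<Sum>s | s \<in> {a..t} \<and> omega f s \<noteq> 0. omega f s)"
  define D where "D = (\<lambda>t. right_slope f t - W t)"
  have "D b = D a"
  proof (rule connected_local_const[of "{a..}" b a D])
    show "\<forall>t\<in>{a..}. \<forall>\<^sub>F u in at t within {a..}. D t = D u"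
    proof
      fix t assume t: "t \<in> {a..}"
      obtain lo where lo: "lo < t" "\<And>u. lo < u \<Longrightarrow> u < t \<Longrightarrow> omega f u = 0 \<and> right_slope f u = left_slope f t"
        using slopes_near(1)[OF f, of t] unfolding eventually_at_left_field by blast
      obtain hi where hi: "t < hi" "\<And>u. t < u \<Longrightarrow> u < hi \<Longrightarrow> omega f u = 0 \<and> right_slope f u = right_slope f t"
        using slopes_near(2)[OF f, of t] unfolding eventually_at_right_field by blast
      have "D u = D t" if u: "lo < u" "u < hi" "a \<le> u" for u
      proof (cases u t rule: linorder_cases)
        case less
        have split: "{s. s \<in> {a..t} \<and> omega f s \<noteq> 0}
             = {s. s \<in> {a..u} \<and> omega f s \<noteq> 0} \<union> {s. s = t \<and> omega f s \<noteq> 0}"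
          using lo(2) less u by (auto, metis less_le_trans not_le_imp_less order_less_le)
        have "W t = W u + (\<Sum>s | s = t \<and> omega f s \<noteq> 0. omega f s)"
          unfolding W_def split
          by (rule sum.union_disjoint[OF finite_breakpoints[OF f bounded_closed_interval]])
             (use less in auto)
        also have "(\<Sum>s | s = t \<and> omega f s \<noteq> 0. omega f s) = omega f t"
          by (cases "omega f t = 0") (auto simp: Collect_conv_if conj_commute cong: conj_cong)
        finally show ?thesis
          using lo(2)[OF u(1) less] by (simp add: D_def right_slope_def)
      next
        case greater
        have "{s. s \<in> {a..u} \<and> omega f s \<noteq> 0} = {s. s \<in> {a..t} \<and> omega f s \<noteq> 0}"
          using hi(2) greater u by (auto, metis le_less_trans not_le_imp_less)
        then show ?thesis
          using hi(2)[OF greater u(2)] by (simp add: D_def W_def)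
      qed simp
      then show "\<forall>\<^sub>F u in at t within {a..}. D t = D u"
        unfolding eventually_at_topological using lo(1) hi(1)
        by (intro exI[of _ "{lo<..<hi}"]) auto
    qed
  qed (use assms in auto)
  moreover have "W a = omega f a"
  proof -
    have "{s. s \<in> {a..a} \<and> omega f s \<noteq> 0} = (if omega f a = 0 then {} else {a})" by auto
    then show ?thesis unfolding W_def by (simp split: if_splits del: atLeastAtMost_iff)
  qed
  ultimately show ?thesis
    by (simp add: D_def W_def right_slope_def)
qed

lemma trop_n_eq:
  assumes f: "piecewise_affine f"
  shows "trop_n t (\<lambda>x. - f x) - trop_n t f = (\<Sum>s | s \<in> {-t..t} \<and> omega f s \<noteq> 0. omega f s)"
proof -
  let ?P = "{s. \<bar>s\<bar> \<le> t \<and> omega f s > 0}" and ?N = "{s. \<bar>s\<bar> \<le> t \<and> omega f s < 0}"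
  have un: "{s. s \<in> {-t..t} \<and> omega f s \<noteq> 0} = ?P \<union> ?N" by (auto simp: abs_le_iff)
  have "finite {s. s \<in> {-t..t} \<and> omega f s \<noteq> 0}"
    by (rule finite_breakpoints[OF f bounded_closed_interval])
  then have fin: "finite ?P" "finite ?N" unfolding un by auto
  have "trop_n t (\<lambda>x. - f x) = sum (omega f) ?P"
    unfolding trop_n_def trop_pole_def omega_minus[OF f] by (intro sum.cong) auto
  moreover have "trop_n t f = - sum (omega f) ?N"
    unfolding trop_n_def trop_pole_def sum_negf[symmetric] by (intro sum.cong) auto
  moreover have "sum (omega f) (?P \<union> ?N) = sum (omega f) ?P + sum (omega f) ?N"
    by (rule sum.union_disjoint[OF fin]) auto
  ultimately show ?thesis unfolding un by simp
qed

lemma trop_n_integrable: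
  assumes f: "piecewise_affine f"
  shows "(\<lambda>t. trop_n t f) integrable_on {0..r}"
proof (rule integrable_on_mono_on, rule mono_onI)
  fix s t :: real assume "s \<le> t"
  have "finite {x \<in> {-t..t}. omega f x \<noteq> 0}"
    by (rule finite_breakpoints[OF f bounded_closed_interval])
  then have "finite {x. \<bar>x\<bar> \<le> t \<and> trop_pole f x}"
    by (rule finite_subset[rotated]) (auto simp: trop_pole_def abs_le_iff)
  then show "trop_n s f \<le> trop_n t f"
    unfolding trop_n_def using \<open>s \<le> t\<close> by (intro sum_mono2) auto
qed

text \<open>The derivative of \<open>f t + f (- t)\<close> is \<open>f' t - f' (- t)\<close>, which is the total jump of the slope on
  \<open>[- t, t]\<close>, that is, the difference of \<open>trop_n\<close> for \<open>- f\<close> and for \<open>f\<close>. Integrating over \<open>[0, r]\<close> gives the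
  formula; the finitely many points \<open>t\<close> with a break point at \<open>t\<close> or \<open>- t\<close> do not affect the integral.\<close>

theorem tropical_Jensen:
  assumes f: "piecewise_affine f" and r: "0 \<le> r"
  shows "trop_N r (\<lambda>x. - f x) - trop_N r f = (f r + f (- r)) / 2 - f 0"
proof -
  have contf: "continuous_on A f" for A
    using piecewise_affine_continuous[OF f] continuous_on_subset by blast
  let ?n = "\<lambda>t. trop_n t (\<lambda>x. - f x) - trop_n t f"
  let ?B = "{s \<in> {-r..r}. omega f s \<noteq> 0}"
  have finB: "finite (?B \<union> uminus ` ?B)"
    using finite_breakpoints[OF f bounded_closed_interval[of "-r" r]] by (intro finite_UnI finite_imageI)
  have "(?n has_integral ((f r + f (- r)) - (f 0 + f (- 0)))) {0..r}"
  proof (rule fundamental_theorem_of_calculus_interior_strong[OF finB r])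
    show "continuous_on {0..r} (\<lambda>t. f t + f (- t))"
      by (rule continuous_on_add[OF contf continuous_on_compose2[OF contf[of UNIV]]])
         (auto intro: continuous_intros)
    fix t assume t: "t \<in> {0<..<r} - (?B \<union> uminus ` ?B)"
    have reg: "omega f t = 0" "omega f (- t) = 0"
    proof -
      have "t \<notin> ?B" "t \<notin> uminus ` ?B" "t \<in> {-r..r}" "- t \<in> {-r..r}" using t by auto
      then show "omega f t = 0" "omega f (- t) = 0"
        by (blast, metis (mono_tags, lifting) imageI mem_Collect_eq minus_minus)
    qed
    have n: "?n t = right_slope f t - left_slope f (- t)"
      using slope_increment[OF f, of "-t" t] t by (simp add: trop_n_eq[OF f])
    have d: "(f has_real_derivative right_slope f t) (at t)"
      "(f has_real_derivative left_slope f (- t)) (at (- t))"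
      using piecewise_affine_corner[OF f, of t] piecewise_affine_corner[OF f, of "- t"] reg
      by (auto intro!: corner_DERIV simp: right_slope_def)
    have "((\<lambda>t. f t + f (- t)) has_real_derivative right_slope f t + left_slope f (- t) * (- 1)) (at t)"
      by (rule DERIV_add[OF d(1) DERIV_chain2[where f = f and g = uminus and x = t, OF d(2)]]) (auto intro!: derivative_eq_intros)
    then show "((\<lambda>t. f t + f (- t)) has_vector_derivative ?n t) (at t)"
      unfolding n has_real_derivative_iff_has_vector_derivative by simp
  qed
  from integral_unique[OF this] have "integral {0..r} ?n = f r + f (- r) - 2 * f 0"
    by simp
  moreover have "integral {0..r} ?n =
      integral {0..r} (\<lambda>t. trop_n t (\<lambda>x. - f x)) - integral {0..r} (\<lambda>t. trop_n t f)"
    by (intro integral_diff trop_n_integrable f piecewise_affine_minus)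
  ultimately show ?thesis by (simp add: trop_N_def field_simps)
qed

section \<open>Functions that rarely double\<close>

text \<open>This is a Borel type estimate with \<open>u\<close> in the role of \<open>ln T\<close>. On the block \<open>[X, 2 X]\<close> the step \<open>r powr a\<close> is
  replaced by its largest value \<open>H\<close>. The integral of \<open>u (r + H) - u r\<close> over the block telescopes to
  boundary terms over intervals of length \<open>H\<close>, and is therefore at most \<open>H * u (4 * X)\<close>. The integrand is
  nonnegative and is at least \<open>ln 2\<close> on the set in question, so Markov's inequality bounds the measure.\<close>

lemma doubling_block_measure:
  fixes u :: "real \<Rightarrow> real" and a b X :: real
  assumes X: "1 \<le> X" and a: "0 < a" "a < 1" and b: "0 \<le> b"
    and cont: "continuous_on {X..} u"
    and mono: "\<And>s t. X \<le> s \<Longrightarrow> s \<le> t \<Longrightarrow> u s \<le> u t"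
    and nonneg: "\<And>t. X \<le> t \<Longrightarrow> 0 \<le> u t"
    and bound: "\<And>t. X \<le> t \<Longrightarrow> u t \<le> t powr b"
  shows "emeasure lborel {r \<in> {X..2 * X}. u r + ln 2 \<le> u (r + r powr a)}
           \<le> ennreal (2 powr a * 4 powr b / ln 2 * X powr (a + b))"
proof -
  define H where "H = (2 * X) powr a"
  define S where "S = {r \<in> {X..2 * X}. u r + ln 2 \<le> u (r + r powr a)}"
  define e where "e = (\<lambda>r. u (r + H) - u r)"
  have H: "0 < H" "H \<le> 2 * X"
    using X a powr_mono[of a 1 "2 * X"] by (auto simp: H_def)
  have contu: "continuous_on A u" if "A \<subseteq> {X..}" for A
    using cont that continuous_on_subset by blast
  have int: "u integrable_on {c..d}" if "X \<le> c" for c d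
    using that by (intro integrable_continuous_real contu) auto
  have S: "S \<in> sets borel"
  proof -
    have "closed S"
      unfolding S_def
    proof (rule continuous_on_closed_Collect_le)
      have "continuous_on {X..2 * X} (\<lambda>r. r + r powr a)"
        using X by (intro continuous_intros) auto
      then show "continuous_on {X..2 * X} (\<lambda>r. u (r + r powr a))"
        by (rule continuous_on_compose2[OF cont]) (auto intro: add_increasing2)
      show "continuous_on {X..2 * X} (\<lambda>r. u r + ln 2)"
        by (intro continuous_intros contu) auto
    qed simp
    then show ?thesis by (simp add: borel_closed)
  qed
  define I where "I = integral {X..2 * X} e"
  have shift: "(\<lambda>r. u (r + H)) integrable_on {X..2 * X}"
    "integral {X..2 * X} (\<lambda>r. u (r + H)) = integral {X + H..2 * X + H} u"
    using integrable_shift_real_ivl[OF int[of "X + H" "2 * X + H"], of H]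
      integral_shift_real_ivl[of "X + H" H "2 * X + H" u] H by auto
  have e_int: "(e has_integral I) {X..2 * X}"
    unfolding I_def e_def using shift(1) int[of X "2 * X"]
    by (intro integrable_integral integrable_diff) auto
  have "I = integral {X + H..2 * X + H} u - integral {X..2 * X} u"
    unfolding I_def e_def shift(2)[symmetric] by (intro Henstock_Kurzweil_Integration.integral_diff shift int) simp
  \<comment> \<open>The integral over \<open>[X, 2 X + H]\<close> is split at \<open>X + H\<close> and at \<open>2 X\<close>.\<close>
  also have "\<dots> = integral {2 * X..2 * X + H} u - integral {X..X + H} u"
    using Henstock_Kurzweil_Integration.integral_combine[OF _ _ int[of X "2 * X + H"], of "X + H"]
      Henstock_Kurzweil_Integration.integral_combine[OF _ _ int[of X "2 * X + H"], of "2 * X"] X H by simp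
  also have "\<dots> \<le> integral {2 * X..2 * X + H} u"
    using nonneg by (auto intro!: Henstock_Kurzweil_Integration.integral_nonneg int)
  also have "\<dots> \<le> integral {2 * X..2 * X + H} (\<lambda>_. u (4 * X))"
    using X H by (intro integral_le int mono) auto
  also have "\<dots> = H * u (4 * X)" using H by simp
  also have "\<dots> \<le> H * (4 * X) powr b"
    using H X bound[of "4 * X"] by (intro mult_left_mono) auto
  also have "\<dots> = 2 powr a * 4 powr b * X powr (a + b)"
    using X by (simp add: H_def powr_mult powr_add)
  finally have I_le: "I \<le> 2 powr a * 4 powr b * X powr (a + b)" .
  have "ennreal (ln 2) * emeasure lborel S = (\<integral>\<^sup>+r. ennreal (ln 2) * indicator S r \<partial>lborel)"
    using S by (simp add: nn_integral_cmult_indicator)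
  also have "\<dots> \<le> (\<integral>\<^sup>+r. ennreal (e r) * indicator {X..2 * X} r \<partial>lborel)"
  proof (rule nn_integral_mono)
    fix r
    have "ln 2 \<le> e r" if r: "r \<in> S"
    proof -
      have "r powr a \<le> H"
        unfolding H_def using r a X by (intro powr_mono2) (auto simp: S_def)
      then have "u (r + r powr a) \<le> u (r + H)"
        using r H by (intro mono) (auto simp: S_def intro: add_increasing2)
      then show ?thesis using r by (simp add: S_def e_def)
    qed
    moreover have "r \<in> {X..2 * X}" if "r \<in> S" using that by (simp add: S_def)
    ultimately show "ennreal (ln 2) * indicator S r \<le> ennreal (e r) * indicator {X..2 * X} r"
      by (auto simp: indicator_def intro: ennreal_leI)
  qed
  also have "\<dots> = ennreal I"
    using H mono by (intro nn_integral_has_integral_lebesgue'[OF _ e_int]) (auto simp: e_def)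
  also have "\<dots> \<le> ennreal (2 powr a * 4 powr b * X powr (a + b))"
    using I_le by (rule ennreal_leI)
  also have "\<dots> = ennreal (ln 2) * ennreal (2 powr a * 4 powr b / ln 2 * X powr (a + b))"
    by (subst ennreal_mult[symmetric]) auto
  finally show ?thesis
    unfolding S_def[symmetric]
    by (subst (asm) ennreal_mult_le_mult_iff) auto
qed

text \<open>On the dyadic block starting at \<open>X\<close> the exceptional set has measure \<open>O(X powr (a + b))\<close>, hence
  logarithmic measure \<open>O(X powr (a + b - 1))\<close>. As \<open>a + b < 1\<close>, the sum over all blocks is a convergent
  geometric series.\<close>

lemma doubling_outside_finite_log_measure:
  fixes T :: "real \<Rightarrow> real" and a b :: real
  assumes a: "0 < a" and b: "0 \<le> b" and ab: "a + b < 1"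
    and cont: "continuous_on UNIV T" and mono: "mono_on {0..} T"
    and large: "\<forall>\<^sub>F r in at_top. 1 \<le> T r"
    and bound: "\<forall>\<^sub>F r in at_top. ln (T r) \<le> r powr b"
  shows "\<exists>E. finite_log_measure E \<and> (\<forall>\<^sub>F r in at_top. r \<notin> E \<longrightarrow> T (r + r powr a) \<le> 2 * T r)"
proof -
  obtain R where R: "\<And>r. r \<ge> R \<Longrightarrow> 1 \<le> T r \<and> ln (T r) \<le> r powr b"
    using eventually_conj[OF large bound] unfolding eventually_at_top_linorder by blast
  \<comment> \<open>Blocks start at a power of two beyond which both asymptotic bounds hold.\<close>
  obtain K where K: "R < 2 ^ K" using real_arch_pow[of 2 R] by auto
  define X where "X = (\<lambda>k::nat. (2::real) ^ (k + K))"
  define u where "u = (\<lambda>r. ln (T r))"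
  define S where "S = (\<lambda>k. {r \<in> {X k..2 * X k}. u r + ln 2 \<le> u (r + r powr a)})"
  define E where "E = (\<Union>k. S k)"
  define C where "C = 2 powr a * 4 powr b / ln 2 * (2 ^ K) powr (a + b - 1)"
  have X1: "1 \<le> X k" for k by (simp add: X_def)
  have RX: "R \<le> X k" for k
  proof -
    have "2 ^ K \<le> X k" by (simp add: X_def)
    then show ?thesis using K by simp
  qed
  have contu: "continuous_on {X k..} u" for k
    unfolding u_def
  proof (rule continuous_on_ln)
    show "\<forall>x\<in>{X k..}. T x \<noteq> 0"
    proof
      fix x assume "x \<in> {X k..}"
      then have "1 \<le> T x" using R[of x] RX[of k] by simp
      then show "T x \<noteq> 0" by simp
    qed
  qed (rule continuous_on_subset[OF cont subset_UNIV])
  have monou: "u s \<le> u t" if "X k \<le> s" "s \<le> t" for k s t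
    unfolding u_def using R[of s] RX[of k] X1[of k] that mono_onD[OF mono, of s t] by simp
  have meas: "emeasure lborel (S k) \<le> ennreal (2 powr a * 4 powr b / ln 2 * X k powr (a + b))" for k
    unfolding S_def
  proof (rule doubling_block_measure[OF X1 a _ b contu monou])
    show "a < 1" using ab b by simp
    fix t assume "X k \<le> t"
    then show "0 \<le> u t" "u t \<le> t powr b" using R[of t] RX[of k] by (auto simp: u_def)
  qed auto
  have Sb: "S k \<in> sets borel" for k
  proof -
    have "closed (S k)"
      unfolding S_def
    proof (rule continuous_on_closed_Collect_le)
      have "continuous_on {X k..2 * X k} (\<lambda>r. r + r powr a)"
        using X1[of k] by (intro continuous_intros) auto
      then show "continuous_on {X k..2 * X k} (\<lambda>r. u (r + r powr a))"
        by (rule continuous_on_compose2[OF contu[of k]]) (auto intro: add_increasing2)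
      show "continuous_on {X k..2 * X k} (\<lambda>r. u r + ln 2)"
        by (intro continuous_intros continuous_on_subset[OF contu[of k]]) auto
    qed simp
    then show ?thesis by (simp add: borel_closed)
  qed
  have "finite_log_measure E"
    unfolding finite_log_measure_def
  proof (intro conjI)
    show "E \<subseteq> {0..}"
    proof
      fix x assume "x \<in> E"
      then obtain k where "X k \<le> x" by (auto simp: E_def S_def)
      then show "x \<in> {0..}" using X1[of k] by simp
    qed
    have "E \<in> sets borel" using Sb by (auto simp: E_def)
    then show "E \<in> sets lebesgue" by simp
    have Sl: "S k \<in> sets lebesgue" for k using Sb[of k] by simp
    have "(\<integral>\<^sup>+ r \<in> E \<inter> {1..}. ennreal (1 / r) \<partial>lebesgue)
          \<le> (\<integral>\<^sup>+ r. (\<Sum>k. ennreal (1 / X k) * indicator (S k) r) \<partial>lebesgue)"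
    proof (rule nn_integral_mono)
      fix r :: real
      show "ennreal (1 / r) * indicator (E \<inter> {1..}) r \<le> (\<Sum>k. ennreal (1 / X k) * indicator (S k) r)"
      proof (cases "r \<in> E")
        case True
        then obtain k where k: "r \<in> S k" by (auto simp: E_def)
        then have "1 / r \<le> 1 / X k" using X1[of k] by (auto simp: S_def intro: divide_left_mono)
        then have "ennreal (1 / r) * indicator (E \<inter> {1..}) r \<le> ennreal (1 / X k) * indicator (S k) r"
          using k by (auto simp: indicator_def intro: ennreal_leI)
        also have "\<dots> \<le> (\<Sum>k. ennreal (1 / X k) * indicator (S k) r)"
          using sum_le_suminf[of "\<lambda>k. ennreal (1 / X k) * indicator (S k) r" "{k}", OF summableI]
          by (simp only: finite.intros sum.insert sum.empty empty_iff not_False_eq_True add_0_right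
              zero_le UNIV_I simp_thms ball_simps)
        finally show ?thesis .
      qed simp
    qed
    also have "\<dots> = (\<Sum>k. \<integral>\<^sup>+ r. ennreal (1 / X k) * indicator (S k) r \<partial>lebesgue)"
      using Sl by (intro nn_integral_suminf borel_measurable_times_ennreal borel_measurable_indicator) auto
    also have "\<dots> = (\<Sum>k. ennreal (1 / X k) * emeasure lebesgue (S k))"
      using Sl by (simp only: nn_integral_cmult_indicator)
    also have "\<dots> = (\<Sum>k. ennreal (1 / X k) * emeasure lborel (S k))"
      using Sb by (simp add: emeasure_completion)
    also have "\<dots> \<le> (\<Sum>k. ennreal (C * (2 powr (a + b - 1)) ^ k))"
    proof (intro suminf_le summableI)
      fix k
      have "ennreal (1 / X k) * emeasure lborel (S k)
          \<le> ennreal (1 / X k) * ennreal (2 powr a * 4 powr b / ln 2 * X k powr (a + b))"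
        by (intro mult_left_mono meas) auto
      also have "\<dots> = ennreal (1 / X k * (2 powr a * 4 powr b / ln 2 * X k powr (a + b)))"
        using X1[of k] by (intro ennreal_mult[symmetric]) auto
      also have "1 / X k * (2 powr a * 4 powr b / ln 2 * X k powr (a + b))
          = 2 powr a * 4 powr b / ln 2 * X k powr (a + b - 1)"
        using X1[of k] by (simp add: powr_diff)
      also have "X k powr (a + b - 1) = (2 ^ K) powr (a + b - 1) * (2 powr (a + b - 1)) ^ k"
        by (simp add: X_def power_add powr_mult powr_powr mult.commute flip: powr_realpow)
      finally show "ennreal (1 / X k) * emeasure lborel (S k)
          \<le> ennreal (C * (2 powr (a + b - 1)) ^ k)"
        by (simp add: C_def mult.assoc)
    qed
    also have "\<dots> = ennreal (\<Sum>k. C * (2 powr (a + b - 1)) ^ k)"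
    proof (rule suminf_ennreal2)
      have "2 powr (a + b - 1) < (1::real)" using ab powr_less_mono[of "a + b - 1" 0 "2::real"] by simp
      then show "summable (\<lambda>k. C * (2 powr (a + b - 1)) ^ k)"
        by (intro summable_mult summable_geometric) simp
    qed (simp add: C_def)
    also have "\<dots> < \<infinity>" by simp
    finally show "(\<integral>\<^sup>+ r \<in> E \<inter> {1..}. ennreal (1 / r) \<partial>lebesgue) < \<infinity>" .
  qed
  moreover have "T (r + r powr a) \<le> 2 * T r" if r: "r \<ge> 2 ^ K" "r \<notin> E" for r
  proof -
    have "\<exists>k. X k \<le> r \<and> r \<le> 2 * X k"
    proof -
      have r0: "0 < r" using r(1) by (meson less_le_trans zero_less_numeral zero_less_power)
      define j where "j = nat \<lfloor>log 2 r\<rfloor>"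
      have "real K \<le> log 2 r" using r(1) r0 by (simp add: le_log_iff powr_realpow)
      then have j: "K \<le> j" "real j \<le> log 2 r" "log 2 r \<le> real j + 1"
        unfolding j_def by linarith+
      have "2 ^ j \<le> r" "r \<le> 2 * 2 ^ j"
        using j(2,3) r0 by (simp_all add: le_log_iff log_le_iff powr_realpow powr_add mult.commute)
      then show ?thesis
        using j(1) by (intro exI[of _ "j - K"]) (simp add: X_def)
    qed
    then obtain k where k: "X k \<le> r" "r \<le> 2 * X k" by blast
    then have less: "u (r + r powr a) < u r + ln 2"
      using r(2) by (force simp: E_def S_def)
    have pos: "0 < T r" "0 < T (r + r powr a)"
    proof -
      have "R \<le> r" "R \<le> r + r powr a"
        using RX[of k] k by (auto intro: add_increasing2)
      then have "1 \<le> T r" "1 \<le> T (r + r powr a)" using R by blast+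
      then show "0 < T r" "0 < T (r + r powr a)" by linarith+
    qed
    then have "ln (T (r + r powr a)) < ln (2 * T r)"
      using less by (simp add: u_def ln_mult)
    then show ?thesis using pos by simp
  qed
  ultimately show ?thesis
    by (intro exI[of _ E]) (auto simp: eventually_at_top_linorder)
qed

section \<open>Convex functions on the line\<close>

lemma convex_supporting_line:
  fixes f :: "real \<Rightarrow> real"
  assumes "convex_on UNIV f"
  shows "\<exists>s. \<forall>y. f x + s * (y - x) \<le> f y"
  using convex_le_Inf_differential[OF assms, of x]
  by (intro exI[of _ "Inf ((\<lambda>t. (f x - f t) / (x - t)) ` ({x<..} \<inter> UNIV))"]) auto

lemma convex_symmetric_ge:
  fixes f :: "real \<Rightarrow> real"
  assumes "convex_on UNIV f"
  shows "2 * f 0 \<le> f r + f (- r)"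
proof -
  obtain s where s: "\<And>y. f 0 + s * (y - 0) \<le> f y" using convex_supporting_line[OF assms] by blast
  show ?thesis using s[of r] s[of "- r"] by simp
qed

text \<open>A supporting line of nonzero slope would be unbounded above, so every supporting line is horizontal
  and every point is a minimum.\<close>

lemma convex_bounded_above_const:
  fixes f :: "real \<Rightarrow> real"
  assumes "convex_on UNIV f" "\<And>x. f x \<le> B"
  shows "f x = f y"
proof -
  have "f x \<le> f y" for x y
  proof -
    obtain s where s: "\<And>y. f x + s * (y - x) \<le> f y" using convex_supporting_line[OF assms(1)] by blast
    have "s = 0"
    proof (rule ccontr)
      assume "s \<noteq> 0"
      then have "f x + s * ((x + (B - f x + 1) / s) - x) = B + 1" by simp
      then show False using s[of "x + (B - f x + 1) / s"] assms(2)[of "x + (B - f x + 1) / s"] by linarith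
    qed
    then show ?thesis using s[of y] by simp
  qed
  then show ?thesis by (meson order_antisym)
qed

lemma convex_reflect:
  fixes f :: "real \<Rightarrow> real"
  assumes "convex_on UNIV f"
  shows "convex_on UNIV (\<lambda>x. f (- x))"
proof (rule convex_onI)
  fix t x y :: real assume "0 < t" "t < 1"
  then show "f (- ((1 - t) *\<^sub>R x + t *\<^sub>R y)) \<le> (1 - t) * f (- x) + t * f (- y)"
    using convex_onD[OF assms, of t "- x" "- y"] by (simp add: algebra_simps)
qed simp

text \<open>Both \<open>x + p\<close> and \<open>y\<close> are convex combinations of \<open>x\<close> and \<open>y + p\<close>, with interchanged weights; the two
  convexity inequalities are added.\<close>

lemma convex_increment_mono:
  fixes f :: "real \<Rightarrow> real"
  assumes f: "convex_on UNIV f" and "x \<le> y" "0 \<le> p"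
  shows "f (x + p) - f x \<le> f (y + p) - f y"
proof (cases "y - x + p = 0")
  case True
  then have "p = 0" "x = y" using assms(2,3) by auto
  then show ?thesis by simp
next
  case False
  define t where "t = p / (y - x + p)"
  have t: "0 \<le> t" "t \<le> 1" and tp: "t * (y - x + p) = p"
    using False assms(2,3) by (auto simp: t_def divide_le_eq)
  have "f (x + p) = f ((1 - t) *\<^sub>R x + t *\<^sub>R (y + p))"
    using tp by (simp add: algebra_simps)
  also have "\<dots> \<le> (1 - t) * f x + t * f (y + p)"
    using convex_onD[OF f t] by simp
  finally have 1: "f (x + p) \<le> (1 - t) * f x + t * f (y + p)" .
  have "f y = f ((1 - t) *\<^sub>R (y + p) + t *\<^sub>R x)"
    using tp by (simp add: algebra_simps)
  also have "\<dots> \<le> (1 - t) * f (y + p) + t * f x"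
    using convex_onD[OF f t] by simp
  finally have 2: "f y \<le> (1 - t) * f (y + p) + t * f x" .
  show ?thesis using 1 2 by (simp add: algebra_simps)
qed

lemma convex_increment_le_chord:
  fixes f :: "real \<Rightarrow> real"
  assumes f: "convex_on UNIV f" and "0 \<le> p" "p \<le> h" "0 < h"
  shows "f (x + p) - f x \<le> p / h * (f (x + h) - f x)"
proof -
  have "x + p = (1 - p / h) *\<^sub>R x + (p / h) *\<^sub>R (x + h)"
    using assms(4) by (simp add: field_simps)
  then have "f (x + p) = f ((1 - p / h) *\<^sub>R x + (p / h) *\<^sub>R (x + h))"
    by (rule arg_cong)
  also have "\<dots> \<le> (1 - p / h) * f x + p / h * f (x + h)"
    using assms by (intro convex_onD[OF f]) auto
  finally show ?thesis by (simp add: algebra_simps)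
qed

lemma convex_on_Max:
  fixes f :: "'i \<Rightarrow> real \<Rightarrow> real"
  assumes "finite A" "A \<noteq> {}" "\<And>i. i \<in> A \<Longrightarrow> convex_on UNIV (f i)"
  shows "convex_on UNIV (\<lambda>x. Max ((\<lambda>i. f i x) ` A))"
proof (rule convex_onI)
  fix t x y :: real assume t: "0 < t" "t < 1"
  show "Max ((\<lambda>i. f i ((1 - t) *\<^sub>R x + t *\<^sub>R y)) ` A)
      \<le> (1 - t) * Max ((\<lambda>i. f i x) ` A) + t * Max ((\<lambda>i. f i y) ` A)"
  proof (rule Max.boundedI)
    fix z assume "z \<in> (\<lambda>i. f i ((1 - t) *\<^sub>R x + t *\<^sub>R y)) ` A"
    then obtain i where i: "i \<in> A" and z: "z = f i ((1 - t) *\<^sub>R x + t *\<^sub>R y)" by blast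
    have "z \<le> (1 - t) * f i x + t * f i y"
      unfolding z using t by (intro convex_onD[OF assms(3)[OF i]]) auto
    also have "\<dots> \<le> (1 - t) * Max ((\<lambda>i. f i x) ` A) + t * Max ((\<lambda>i. f i y) ` A)"
      using t i assms(1) by (intro add_mono mult_left_mono Max_ge) auto
    finally show "z \<le> (1 - t) * Max ((\<lambda>i. f i x) ` A) + t * Max ((\<lambda>i. f i y) ` A)" .
  qed (use assms in auto)
qed simp

section \<open>Tropical linear combinations\<close>

definition curve_max :: "nat \<Rightarrow> (nat \<Rightarrow> real \<Rightarrow> real) \<Rightarrow> real \<Rightarrow> real" where
  "curve_max n g x = Max ((\<lambda>j. g j x) ` {0..n})"

lemma trop_cartan_eq:
  "trop_cartan n g r = (curve_max n g r + curve_max n g (- r)) / 2 - curve_max n g 0"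
  by (simp add: trop_cartan_def curve_max_def Let_def)

lemma curve_max_ge: "j \<le> n \<Longrightarrow> g j x \<le> curve_max n g x"
  unfolding curve_max_def by (intro Max_ge) auto

text \<open>Terms with coefficient \<open>-\<infinity>\<close> never contribute, and all other coefficients are real. This moves the
  combination from \<open>ereal\<close> to a maximum of finitely many real functions.\<close>

lemma trop_lin_comb_Max:
  fixes a :: "nat \<Rightarrow> ereal"
  assumes f: "trop_lin_comb_of n g a f"
  defines "K \<equiv> {i \<in> {0..n}. a i \<noteq> -\<infinity>}"
  shows "K \<noteq> {}" and "f x = Max ((\<lambda>i. real_of_ereal (a i) + g i x) ` K)"
proof -
  show K: "K \<noteq> {}" using f by (auto simp: trop_lin_comb_of_def K_def)
  have real: "a i + ereal (g i x) = ereal (real_of_ereal (a i) + g i x)" if "i \<in> K" for i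
    using f that by (cases "a i") (auto simp: trop_lin_comb_of_def Rmax_def K_def)
  have fx: "ereal (f x) = (SUP i\<in>{0..n}. a i + ereal (g i x))"
    using f by (simp add: trop_lin_comb_of_def trop_comb_def)
  let ?M = "Max ((\<lambda>i. real_of_ereal (a i) + g i x) ` K)"
  have "ereal (f x) \<le> ereal ?M"
    unfolding fx
  proof (rule SUP_least)
    fix i assume i: "i \<in> {0..n}"
    show "a i + ereal (g i x) \<le> ereal ?M"
    proof (cases "a i = -\<infinity>")
      case False
      then have "i \<in> K" using i by (simp add: K_def)
      then show ?thesis unfolding real[OF \<open>i \<in> K\<close>] by (simp add: K_def)
    qed simp
  qed
  moreover have "?M \<le> f x"
  proof (rule Max.boundedI)
    fix z assume "z \<in> (\<lambda>i. real_of_ereal (a i) + g i x) ` K"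
    then obtain i where i: "i \<in> K" and z: "z = real_of_ereal (a i) + g i x" by blast
    have "ereal z = a i + ereal (g i x)" by (simp add: z real[OF i])
    also have "\<dots> \<le> ereal (f x)"
      unfolding fx using i by (intro SUP_upper) (simp add: K_def)
    finally show "z \<le> f x" by simp
  qed (use K in \<open>auto simp: K_def\<close>)
  ultimately show "f x = ?M" by simp
qed

lemma trop_lin_comb_upper:
  assumes f: "trop_lin_comb_of n g a f"
  obtains c where "\<And>x. f x \<le> curve_max n g x + c"
proof
  let ?K = "{i \<in> {0..n}. a i \<noteq> -\<infinity>}"
  let ?c = "Max ((\<lambda>i. real_of_ereal (a i)) ` ?K)"
  fix x
  show "f x \<le> curve_max n g x + ?c"
    unfolding trop_lin_comb_Max(2)[OF f]
  proof (rule Max.boundedI)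
    fix z assume "z \<in> (\<lambda>i. real_of_ereal (a i) + g i x) ` ?K"
    then obtain i where i: "i \<in> ?K" and z: "z = real_of_ereal (a i) + g i x" by blast
    have "real_of_ereal (a i) \<le> ?c" using i by (intro Max_ge) auto
    moreover have "g i x \<le> curve_max n g x" using i by (intro curve_max_ge) auto
    ultimately show "z \<le> curve_max n g x + ?c" by (simp add: z)
  qed (use trop_lin_comb_Max(1)[OF f] in auto)
qed

text \<open>Dropping a term with coefficient \<open>-\<infinity>\<close> leaves a representation with at most \<open>n\<close> terms.\<close>

lemma nondegenerate_coeffs_finite:
  assumes f: "trop_lin_comb_of n g a f" and nd: "\<not> trop_length n g f < n + 1" and i: "i \<le> n"
  shows "a i \<noteq> -\<infinity>"
proof
  assume ai: "a i = -\<infinity>"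
  let ?K = "{i \<in> {0..n}. a i \<noteq> -\<infinity>}"
  have "i \<notin> ?K" "i \<in> {0..n}" using ai i by simp_all
  then have "?K \<subset> {0..n}" by blast
  from psubset_card_mono[OF _ this] have less: "card ?K < n + 1" by simp
  have "card ?K \<noteq> 0" using trop_lin_comb_Max(1)[OF f] by simp
  then have "card ?K \<in> {1..n + 1}" using less by (intro atLeastAtMost_iff[THEN iffD2] conjI; linarith)
  then have "trop_length n g f \<le> card ?K"
    unfolding trop_length_def
  proof (intro Least_le conjI exI[of _ ?K] exI[of _ "\<lambda>i. real_of_ereal (a i)"] allI)
    show "f x = Max ((\<lambda>i. real_of_ereal (a i) + g i x) ` ?K)" for x
      by (rule trop_lin_comb_Max(2)[OF f])
  qed auto
  then show False using less nd by simp
qed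

lemma nondegenerate_lower:
  assumes f: "trop_lin_comb_of n g a f" and nd: "\<not> trop_length n g f < n + 1"
  obtains c where "\<And>x. curve_max n g x - c \<le> f x"
proof
  let ?c = "- Min ((\<lambda>i. real_of_ereal (a i)) ` {0..n})"
  have K: "{i \<in> {0..n}. a i \<noteq> -\<infinity>} = {0..n}"
    using nondegenerate_coeffs_finite[OF f nd] by auto
  fix x
  have "curve_max n g x \<le> f x + ?c"
    unfolding curve_max_def
  proof (rule Max.boundedI)
    fix z assume "z \<in> (\<lambda>j. g j x) ` {0..n}"
    then obtain i where i: "i \<in> {0..n}" and z: "z = g i x" by blast
    have "real_of_ereal (a i) + g i x \<le> f x"
      unfolding trop_lin_comb_Max(2)[OF f, of x] K using i by (intro Max_ge) auto
    moreover have "Min ((\<lambda>i. real_of_ereal (a i)) ` {0..n}) \<le> real_of_ereal (a i)"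
      using i by (intro Min_le) auto
    ultimately show "z \<le> f x + ?c" unfolding z by linarith
  qed auto
  then show "curve_max n g x - ?c \<le> f x" by (simp only: diff_le_eq)
qed

lemma trop_lin_comb_piecewise_affine:
  assumes "\<And>j. j \<le> n \<Longrightarrow> piecewise_affine (g j)" and f: "trop_lin_comb_of n g a f"
  shows "piecewise_affine f"
proof -
  have "f = (\<lambda>x. Max ((\<lambda>i. real_of_ereal (a i) + g i x) ` {i \<in> {0..n}. a i \<noteq> -\<infinity>}))"
    using trop_lin_comb_Max(2)[OF f] by blast
  moreover have "piecewise_affine \<dots>"
    using trop_lin_comb_Max(1)[OF f] assms(1)
    by (intro piecewise_affine_Max piecewise_affine_add piecewise_affine_const) auto
  ultimately show ?thesis by simp
qed

lemma trop_lin_comb_convex: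
  assumes "\<And>j. j \<le> n \<Longrightarrow> convex_on UNIV (g j)" and f: "trop_lin_comb_of n g a f"
  shows "convex_on UNIV f"
proof -
  have "f = (\<lambda>x. Max ((\<lambda>i. real_of_ereal (a i) + g i x) ` {i \<in> {0..n}. a i \<noteq> -\<infinity>}))"
    using trop_lin_comb_Max(2)[OF f] by blast
  moreover have "convex_on UNIV \<dots>"
    using trop_lin_comb_Max(1)[OF f] assms(1)
    by (intro convex_on_Max convex_on_add) (auto simp: convex_on_const)
  ultimately show ?thesis by simp
qed

section \<open>The Cartan characteristic of a curve with convex components\<close>

locale convex_curve =
  fixes n :: nat and g :: "nat \<Rightarrow> real \<Rightarrow> real"
  assumes convex: "\<And>j. j \<le> n \<Longrightarrow> convex_on UNIV (g j)"
begin

abbreviation "F \<equiv> curve_max n g"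
abbreviation "T \<equiv> trop_cartan n g"

lemma convex_F: "convex_on UNIV F"
  unfolding curve_max_def[abs_def] using convex by (intro convex_on_Max) auto

lemma convex_T: "convex_on UNIV T"
proof -
  have "T = (\<lambda>r. (1 / 2) * (F r + F (- r)) + (- F 0))"
    by (auto simp: trop_cartan_eq)
  then show ?thesis
    using convex_F convex_reflect by (simp only:) (intro convex_on_add convex_on_cmul; simp add: convex_on_const)
qed

lemma T_zero: "T 0 = 0"
  by (simp add: trop_cartan_eq)

lemma T_nonneg: "0 \<le> T r"
  using convex_symmetric_ge[OF convex_F, of r] by (simp add: trop_cartan_eq)

lemma T_scale: "0 \<le> t \<Longrightarrow> t \<le> 1 \<Longrightarrow> T (t * r) \<le> t * T r"
  using convex_onD[OF convex_T, of t 0 r] by (simp add: T_zero)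

lemma T_mono: "mono_on {0..} T"
proof (rule mono_onI)
  fix r s :: real assume rs: "r \<in> {0..}" "s \<in> {0..}" "r \<le> s"
  show "T r \<le> T s"
  proof (cases "s = 0")
    case False
    then have t: "0 \<le> r / s" "r / s \<le> 1" using rs by (auto simp: divide_le_eq)
    have "T r \<le> r / s * T s" using T_scale[OF t, of s] False by simp
    also have "\<dots> \<le> 1 * T s" using t T_nonneg by (intro mult_right_mono)
    finally show ?thesis by simp
  qed (use rs in simp)
qed

lemma T_continuous: "continuous_on UNIV T"
  by (rule convex_on_continuous[OF open_UNIV convex_T])

text \<open>This is where independence enters. If the characteristic vanished on the positive reals, then \<open>F x - F 0\<close>
  would be an odd convex function, so \<open>- F\<close> would be convex as well. Each \<open>g j - F\<close> would then be convex
  and bounded above by \<open>0\<close>, hence constant, and any two of the \<open>g j\<close> would differ by a constant.\<close>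

lemma T_positive:
  assumes n: "0 < n" and indep: "\<not> GM_dependent n g"
  obtains r where "0 < r" "0 < T r"
proof -
  have False if "\<And>r. r > 0 \<Longrightarrow> T r = 0"
  proof -
    have odd: "F r + F (- r) = 2 * F 0" for r
      using that[of r] that[of "- r"] by (cases r "0::real" rule: linorder_cases) (auto simp: trop_cartan_eq)
    have "(\<lambda>x. - F x) = (\<lambda>x. F (- x) + (- 2 * F 0))"
      using odd by (auto simp: algebra_simps)
    moreover have "convex_on UNIV (\<lambda>x. F (- x) + (- 2 * F 0))"
      by (intro convex_on_add convex_reflect[OF convex_F]) (simp add: convex_on_const)
    ultimately have concF: "convex_on UNIV (\<lambda>x. - F x)" by simp
    have const: "g j x - F x = g j 0 - F 0" if j: "j \<le> n" for j x
    proof -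
      have "convex_on UNIV (\<lambda>x. g j x + - F x)"
        by (intro convex_on_add convex[OF j] concF)
      then show ?thesis
        using convex_bounded_above_const[of "\<lambda>x. g j x + - F x" 0 x 0] curve_max_ge[OF j] by simp
    qed
    \<comment> \<open>Only \<open>g 0\<close> and \<open>g 1\<close> receive real weights; there are two such indices because \<open>0 < n\<close>.\<close>
    define \<alpha> where "\<alpha> = (\<lambda>j::nat. if j \<le> 1 then ereal (F 0 - g j 0) else -\<infinity>)"
    have shifted: "\<alpha> j + ereal (g j x) = ereal (F x)" if "j \<le> 1" for j x
      using const[of j x] n that by (simp add: \<alpha>_def)
    have "trop_comb {0} \<alpha> g x = trop_comb {1..n} \<alpha> g x" for x
    proof -
      have "(SUP i\<in>{1..n}. \<alpha> i + ereal (g i x)) = ereal (F x)"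
      proof (rule antisym)
        show "(SUP i\<in>{1..n}. \<alpha> i + ereal (g i x)) \<le> ereal (F x)"
        proof (rule SUP_least)
          fix i
          show "\<alpha> i + ereal (g i x) \<le> ereal (F x)"
            using shifted[of i x] by (cases "i \<le> 1") (auto simp: \<alpha>_def)
        qed
        show "ereal (F x) \<le> (SUP i\<in>{1..n}. \<alpha> i + ereal (g i x))"
          using n shifted[of 1 x] by (intro SUP_upper2[of 1]) auto
      qed
      then show ?thesis using shifted[of 0 x] by (simp add: trop_comb_def)
    qed
    then have "GM_dependent n g"
      unfolding GM_dependent_def
      by (intro exI[of _ "{0}"] exI[of _ "{1..n}"] exI[of _ \<alpha>]) (auto simp: \<alpha>_def Rmax_def)
    then show False using indep by simp
  qed
  then show ?thesis using that T_nonneg by (metis less_eq_real_def)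
qed

text \<open>A convex function that vanishes at \<open>0\<close> and is positive at \<open>r0\<close> lies above the line through these two
  points from \<open>r0\<close> on.\<close>

lemma T_linear_growth:
  assumes n: "0 < n" and indep: "\<not> GM_dependent n g"
  obtains c where "0 < c" "\<forall>\<^sub>F r in at_top. c * r \<le> T r"
proof -
  obtain r0 where r0: "0 < r0" "0 < T r0" using T_positive[OF assms] by blast
  have "T r0 / r0 * r \<le> T r" if "r \<ge> r0" for r
  proof -
    have "T r0 \<le> r0 / r * T r" using T_scale[of "r0 / r" r] r0 that by simp
    then show ?thesis using r0 that by (simp add: field_simps)
  qed
  then have "\<forall>\<^sub>F r in at_top. T r0 / r0 * r \<le> T r" by (auto simp: eventually_at_top_linorder)
  then show ?thesis using that[of "T r0 / r0"] r0 by simp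
qed

text \<open>At \<open>t = r + h\<close>, \<open>f\<close> is at most \<open>F t\<close> up to a constant, and \<open>F t = 2 * T t + 2 * F 0 - F (- t)\<close>. Supporting lines of
  \<open>F\<close> and \<open>f\<close> at \<open>0\<close> bound \<open>- F (- t)\<close> and \<open>- f r\<close> by linear functions of \<open>t\<close>, and these are \<open>O(T t)\<close> because
  the characteristic grows at least linearly.\<close>

lemma increment_le_T:
  assumes f: "convex_on UNIV f" and upper: "\<And>x. f x \<le> F x + d"
    and c: "0 < c" "\<forall>\<^sub>F r in at_top. c * r \<le> T r"
  shows "\<exists>K\<ge>0. \<forall>\<^sub>F r in at_top. \<forall>h\<ge>0. f (r + h) - f r \<le> K * T (r + h)"
proof -
  obtain s where s: "\<And>y. f 0 + s * (y - 0) \<le> f y" using convex_supporting_line[OF f] by blast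
  obtain \<sigma> where \<sigma>: "\<And>y. F 0 + \<sigma> * (y - 0) \<le> F y" using convex_supporting_line[OF convex_F] by blast
  define A where "A = \<bar>F 0 + d - f 0\<bar> + \<bar>\<sigma>\<bar> + \<bar>s\<bar>"
  have A: "0 \<le> A" by (simp add: A_def)
  have main: "f (r + h) - f r \<le> (2 + A / c) * T (r + h)"
    if r: "1 \<le> r" "0 \<le> h" and T: "c * (r + h) \<le> T (r + h)" for r h
  proof -
    define t where "t = r + h"
    have t: "1 \<le> t" "r \<le> t" "0 \<le> r" using r by (auto simp: t_def)
    have "F t = 2 * T t + 2 * F 0 - F (- t)" by (simp add: trop_cartan_eq field_simps)
    moreover have "F 0 - \<sigma> * t \<le> F (- t)" using \<sigma>[of "- t"] by simp
    ultimately have Ft: "F t \<le> 2 * T t + F 0 + \<sigma> * t" by linarith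
    have "f t - f r \<le> 2 * T t + (F 0 + d - f 0) + \<sigma> * t - s * r"
      using upper[of t] Ft s[of r] by simp
    moreover have "F 0 + d - f 0 \<le> \<bar>F 0 + d - f 0\<bar> * t"
      using mult_mono[of "\<bar>F 0 + d - f 0\<bar>" "\<bar>F 0 + d - f 0\<bar>" 1 t] t by simp
    moreover have "\<sigma> * t \<le> \<bar>\<sigma>\<bar> * t" using t by (intro mult_right_mono) auto
    moreover have "- (s * r) \<le> \<bar>s\<bar> * t"
    proof -
      have "- (s * r) \<le> \<bar>s\<bar> * r" using t by (metis abs_ge_minus_self minus_mult_left mult_right_mono)
      also have "\<dots> \<le> \<bar>s\<bar> * t" using t by (intro mult_left_mono) auto
      finally show ?thesis .
    qed
    moreover have "A * t = \<bar>F 0 + d - f 0\<bar> * t + \<bar>\<sigma>\<bar> * t + \<bar>s\<bar> * t"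
      by (simp add: A_def distrib_right)
    ultimately have "f t - f r \<le> 2 * T t + A * t" by linarith
    moreover have "A * t \<le> A * (T t / c)"
      using T c A by (intro mult_left_mono) (auto simp: t_def field_simps)
    ultimately have "f t - f r \<le> 2 * T t + A * (T t / c)" by linarith
    then show ?thesis by (simp add: t_def distrib_right)
  qed
  obtain R where R: "\<And>r. r \<ge> R \<Longrightarrow> c * r \<le> T r"
    using c(2) unfolding eventually_at_top_linorder by blast
  have "\<forall>\<^sub>F r in at_top. \<forall>h\<ge>0. f (r + h) - f r \<le> (2 + A / c) * T (r + h)"
    unfolding eventually_at_top_linorder
    by (intro exI[of _ "max 1 R"] allI impI main R) auto
  moreover have "0 \<le> 2 + A / c" using A c by simp
  ultimately show ?thesis by blast
qed

end


section \<open>The Casoratian\<close>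

lemma trop_casoratian_le:
  assumes "\<And>j p. j \<le> n \<Longrightarrow> p \<le> n \<Longrightarrow> f j (x + real p) \<le> f j x + D j"
  shows "trop_casoratian n f x \<le> (\<Sum>j = 0..n. f j x) + (\<Sum>j = 0..n. D j)"
  unfolding trop_casoratian_def
proof (rule Max.boundedI)
  fix z assume "z \<in> (\<lambda>\<pi>. \<Sum>j = 0..n. f j (x + real (\<pi> j))) ` {\<pi>. \<pi> permutes {0..n}}"
  then obtain \<pi> where \<pi>: "\<pi> permutes {0..n}" and z: "z = (\<Sum>j = 0..n. f j (x + real (\<pi> j)))" by blast
  have "z \<le> (\<Sum>j = 0..n. f j x + D j)"
    unfolding z
  proof (rule sum_mono)
    fix j assume j: "j \<in> {0..n}"
    then have "\<pi> j \<in> {0..n}" using permutes_in_image[OF \<pi>] by blast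
    then show "f j (x + real (\<pi> j)) \<le> f j x + D j" using j by (intro assms) auto
  qed
  then show "z \<le> (\<Sum>j = 0..n. f j x) + (\<Sum>j = 0..n. D j)" by (simp add: sum.distrib)
qed (auto simp: finite_permutations intro: permutes_id)

lemma trop_casoratian_piecewise_affine:
  assumes "\<And>j. j \<le> n \<Longrightarrow> piecewise_affine (f j)"
  shows "piecewise_affine (trop_casoratian n f)"
  unfolding trop_casoratian_def[abs_def]
  using assms
  by (intro piecewise_affine_Max piecewise_affine_sum piecewise_affine_shift)
     (auto simp: finite_permutations intro: permutes_id)

text \<open>Convexity replaces a lemma on the logarithmic derivative here. Each term of the Casoratian moves the arguments of the
  \<open>f j\<close> by steps of length at most \<open>n\<close>. To the right of \<open>r\<close> the increment over such a step is at most \<open>n / h\<close>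
  times the increment over a step of length \<open>h\<close>, which is \<open>O(T (r + h))\<close>. To the right of \<open>- r\<close> it is at most the
  increment to the right of \<open>0\<close>, a constant.\<close>

lemma (in convex_curve) casoratian_error:
  assumes n: "0 < n" and c: "0 < c" "\<forall>\<^sub>F r in at_top. c * r \<le> T r"
    and f: "\<And>j. j \<le> n \<Longrightarrow> convex_on UNIV (f j)"
    and upper: "\<And>j. j \<le> n \<Longrightarrow> \<exists>d. \<forall>x. f j x \<le> F x + d"
  shows "\<exists>K\<ge>0. \<exists>C. \<forall>\<^sub>F r in at_top. \<forall>h\<ge>real n.
           trop_casoratian n f r + trop_casoratian n f (- r)
             \<le> (\<Sum>j = 0..n. f j r + f j (- r)) + K * (T (r + h) / h) + C"
proof -
  have "\<forall>j\<in>{0..n}. \<exists>K\<ge>0. \<forall>\<^sub>F r in at_top. \<forall>h\<ge>0. f j (r + h) - f j r \<le> K * T (r + h)"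
  proof
    fix j assume j: "j \<in> {0..n}"
    then obtain d where "\<And>x. f j x \<le> F x + d" using upper[of j] by auto
    then show "\<exists>K\<ge>0. \<forall>\<^sub>F r in at_top. \<forall>h\<ge>0. f j (r + h) - f j r \<le> K * T (r + h)"
      using increment_le_T[of "f j" d c] f[of j] c j by simp
  qed
  from bchoice[OF this] obtain K where K0: "\<forall>j\<in>{0..n}. 0 \<le> K j \<and>
      (\<forall>\<^sub>F r in at_top. \<forall>h\<ge>0. f j (r + h) - f j r \<le> K j * T (r + h))" ..
  then have K: "0 \<le> K j" if "j \<in> {0..n}" for j
    using that by blast
  define K' where "K' = real n * (\<Sum>j = 0..n. K j)"
  define C where "C = (\<Sum>j = 0..n. \<bar>f j (real n) - f j 0\<bar>)"
  have "\<forall>\<^sub>F r in at_top. \<forall>j\<in>{0..n}. \<forall>h\<ge>0. f j (r + h) - f j r \<le> K j * T (r + h)"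
    by (rule eventually_ball_finite) (use K0 in simp_all)
  then have "\<forall>\<^sub>F r in at_top. \<forall>h\<ge>real n.
           trop_casoratian n f r + trop_casoratian n f (- r)
             \<le> (\<Sum>j = 0..n. f j r + f j (- r)) + K' * (T (r + h) / h) + C"
    using eventually_ge_at_top[of "0::real"]
  proof eventually_elim
    case (elim r)
    show ?case
    proof (intro allI impI)
      fix h assume h: "h \<ge> real n"
      then have h0: "0 < h" using n by (meson less_le_trans of_nat_0_less_iff)
      have "trop_casoratian n f r \<le> (\<Sum>j = 0..n. f j r) + (\<Sum>j = 0..n. real n / h * (K j * T (r + h)))"
      proof (rule trop_casoratian_le)
        fix j p assume jp: "j \<le> n" "p \<le> n"
        have "f j (r + real p) - f j r \<le> real p / h * (f j (r + h) - f j r)"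
          using jp h h0 by (intro convex_increment_le_chord f) auto
        also have "\<dots> \<le> real p / h * (K j * T (r + h))"
          using elim(1) jp h0 by (intro mult_left_mono) auto
        also have "\<dots> \<le> real n / h * (K j * T (r + h))"
          using jp h0 K[of j] T_nonneg[of "r + h"]
          by (intro mult_right_mono divide_right_mono) auto
        finally show "f j (r + real p) \<le> f j r + real n / h * (K j * T (r + h))" by simp
      qed
      moreover have "trop_casoratian n f (- r) \<le> (\<Sum>j = 0..n. f j (- r)) + C"
        unfolding C_def
      proof (rule trop_casoratian_le)
        fix j p assume jp: "j \<le> n" "p \<le> n"
        have "f j (- r + real p) - f j (- r) \<le> f j (0 + real p) - f j 0"
          using elim(2) jp by (intro convex_increment_mono f) auto
        also have "\<dots> \<le> real p / real n * (f j (0 + real n) - f j 0)"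
          using jp n by (intro convex_increment_le_chord f) auto
        also have "\<dots> \<le> real p / real n * \<bar>f j (real n) - f j 0\<bar>"
          by (intro mult_left_mono) auto
        also have "\<dots> \<le> 1 * \<bar>f j (real n) - f j 0\<bar>"
          using jp n by (intro mult_right_mono) auto
        finally show "f j (- r + real p) \<le> f j (- r) + \<bar>f j (real n) - f j 0\<bar>" by simp
      qed
      moreover have "(\<Sum>j = 0..n. real n / h * (K j * T (r + h))) = K' * (T (r + h) / h)"
        by (simp add: K'_def sum_distrib_left sum_distrib_right sum_divide_distrib mult.assoc)
      ultimately show "trop_casoratian n f r + trop_casoratian n f (- r)
             \<le> (\<Sum>j = 0..n. f j r + f j (- r)) + K' * (T (r + h) / h) + C"
        by (simp add: sum.distrib)
    qed
  qed
  moreover have "0 \<le> K'" unfolding K'_def using K by (intro mult_nonneg_nonneg sum_nonneg) auto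
  ultimately show ?thesis by blast
qed

section \<open>The inequality before the choice of the step\<close>

text \<open>A nondegenerate combination stays within a constant of \<open>F\<close> from below and so contributes the full
  characteristic; a degenerate one is still convex, which bounds its symmetric mean from below.\<close>

lemma (in convex_curve) proximity_lower_bound:
  assumes f: "trop_lin_comb_of n g a f"
  shows "\<exists>C. \<forall>r. (if trop_length n g f < n + 1 then 0 else T r) - C \<le> (f r + f (- r)) / 2"
proof (cases "trop_length n g f < n + 1")
  case True
  then show ?thesis
    using convex_symmetric_ge[OF trop_lin_comb_convex[OF convex f]]
    by (intro exI[of _ "- f 0"]) (simp add: field_simps)
next
  case False
  obtain c where c: "\<And>x. F x - c \<le> f x" using nondegenerate_lower[OF f False] by blast
  have "T r - (c - F 0) \<le> (f r + f (- r)) / 2" for r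
    using c[of r] c[of "- r"] by (simp add: trop_cartan_eq field_simps)
  then show ?thesis using False by (intro exI[of _ "c - F 0"]) simp
qed

text \<open>The first \<open>n + 1\<close> of the \<open>f k\<close> in \<open>L\<close> are used up against the Casoratian, at the cost of its error term. Jensen's
  formula turns the symmetric mean of \<open>L\<close> into the counting functions.\<close>

lemma (in convex_curve) characteristic_le_counting:
  assumes n: "0 < n" and q: "n < q" and c: "0 < c" "\<forall>\<^sub>F r in at_top. c * r \<le> T r"
    and pa: "\<And>j. j \<le> n \<Longrightarrow> piecewise_affine (g j)"
    and f: "\<And>k. k \<le> q \<Longrightarrow> trop_lin_comb_of n g (a k) (f k)"
    and L: "L = (\<lambda>x. (\<Sum>k = 0..q. f k x) - trop_casoratian n f x)"
  shows "\<exists>K\<ge>0. \<exists>C. \<forall>\<^sub>F r in at_top. \<forall>h\<ge>real n.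
           (real q - real n - real (ddg n g (n + 1) q f)) * T r
             \<le> trop_N r (\<lambda>x. - L x) - trop_N r L + K * (T (r + h) / h) + C"
proof -
  have fpa: "piecewise_affine (f k)" if "k \<le> q" for k
    using trop_lin_comb_piecewise_affine[OF pa f[OF that]] .
  have fconv: "convex_on UNIV (f k)" if "k \<le> q" for k
    using trop_lin_comb_convex[OF convex f[OF that]] .
  have Lpa: "piecewise_affine L"
    unfolding L using q
    by (auto simp: diff_conv_add_uminus simp del: add_uminus_conv_diff
        intro!: piecewise_affine_add piecewise_affine_sum piecewise_affine_minus
          trop_casoratian_piecewise_affine fpa)
  have "\<exists>K\<ge>0. \<exists>C. \<forall>\<^sub>F r in at_top. \<forall>h\<ge>real n.
           trop_casoratian n f r + trop_casoratian n f (- r)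
             \<le> (\<Sum>j = 0..n. f j r + f j (- r)) + K * (T (r + h) / h) + C"
  proof (rule casoratian_error[OF n c])
    fix j assume "j \<le> n"
    then have j: "j \<le> q" using q by simp
    show "convex_on UNIV (f j)" by (rule fconv[OF j])
    show "\<exists>d. \<forall>x. f j x \<le> F x + d" using trop_lin_comb_upper[OF f[OF j]] by metis
  qed
  then obtain K C where K: "0 \<le> K" and ev: "\<forall>\<^sub>F r in at_top. \<forall>h\<ge>real n.
           trop_casoratian n f r + trop_casoratian n f (- r)
             \<le> (\<Sum>j = 0..n. f j r + f j (- r)) + K * (T (r + h) / h) + C" by blast
  define deg where "deg = {\<nu> \<in> {n + 1..q}. trop_length n g (f \<nu>) < n + 1}"
  have "\<forall>k\<in>{n + 1..q}. \<exists>C. \<forall>r. (if k \<in> deg then 0 else T r) - C \<le> (f k r + f k (- r)) / 2"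
    using proximity_lower_bound[OF f] by (simp add: deg_def)
  from bchoice[OF this] obtain D where D0: "\<forall>k\<in>{n + 1..q}. \<forall>r.
      (if k \<in> deg then 0 else T r) - D k \<le> (f k r + f k (- r)) / 2" ..
  then have D: "(if k \<in> deg then 0 else T r) - D k \<le> (f k r + f k (- r)) / 2"
    if "k \<in> {n + 1..q}" for k r
    using that by blast
  have count: "(\<Sum>k = n + 1..q. if k \<in> deg then 0 else T r)
      = (real q - real n - real (ddg n g (n + 1) q f)) * T r" for r
  proof -
    have sub: "deg \<subseteq> {n + 1..q}" by (auto simp: deg_def)
    have "(\<Sum>k = n + 1..q. if k \<in> deg then 0 else T r) = (\<Sum>k \<in> {n + 1..q} - deg. T r)"
      by (rule sum.mono_neutral_cong_right) auto
    also have "\<dots> = real (card ({n + 1..q} - deg)) * T r" by simp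
    also have "real (card ({n + 1..q} - deg)) = real q - real n - real (card deg)"
      using card_Diff_subset[OF finite_subset[OF sub finite_atLeastAtMost] sub]
        card_mono[OF finite_atLeastAtMost sub] q by (simp add: of_nat_diff)
    finally show ?thesis by (simp add: ddg_def deg_def)
  qed
  define C' where "C' = (\<Sum>k = n + 1..q. D k) + C / 2 + L 0"
  have "\<forall>\<^sub>F r in at_top. \<forall>h\<ge>real n.
           (real q - real n - real (ddg n g (n + 1) q f)) * T r
             \<le> trop_N r (\<lambda>x. - L x) - trop_N r L + K / 2 * (T (r + h) / h) + C'"
    using ev eventually_ge_at_top[of "0::real"]
  proof eventually_elim
    case (elim r)
    show ?case
    proof (intro allI impI)
      fix h assume h: "h \<ge> real n"
      have "(real q - real n - real (ddg n g (n + 1) q f)) * T r - (\<Sum>k = n + 1..q. D k)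
          \<le> (\<Sum>k = n + 1..q. (f k r + f k (- r)) / 2)"
        unfolding count[symmetric] sum_subtractf[symmetric] by (intro sum_mono D)
      moreover have "(\<Sum>k = n + 1..q. (f k r + f k (- r)) / 2) = (\<Sum>k = n + 1..q. f k r + f k (- r)) / 2"
        by (simp add: sum_divide_distrib)
      moreover have "(\<Sum>k = 0..q. f k r + f k (- r))
          = (\<Sum>j = 0..n. f j r + f j (- r)) + (\<Sum>k = n + 1..q. f k r + f k (- r))"
        using sum.ub_add_nat[of 0 n "\<lambda>k. f k r + f k (- r)" "q - n"] q by simp
      moreover have "L r + L (- r) = (\<Sum>k = 0..q. f k r + f k (- r))
          - (trop_casoratian n f r + trop_casoratian n f (- r))"
        by (simp add: L sum.distrib)
      moreover have "trop_N r (\<lambda>x. - L x) - trop_N r L = (L r + L (- r)) / 2 - L 0"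
        by (rule tropical_Jensen[OF Lpa elim(2)])
      moreover have "trop_casoratian n f r + trop_casoratian n f (- r)
             \<le> (\<Sum>j = 0..n. f j r + f j (- r)) + K * (T (r + h) / h) + C"
        using elim(1) h by blast
      ultimately show "(real q - real n - real (ddg n g (n + 1) q f)) * T r
             \<le> trop_N r (\<lambda>x. - L x) - trop_N r L + K / 2 * (T (r + h) / h) + C'"
        unfolding C'_def by argo
    qed
  qed
  moreover have "0 \<le> K / 2" using K by simp
  ultimately show ?thesis by blast
qed

section \<open>Hyper-order and the choice of the step\<close>

lemma (in convex_curve) hyper_order_nonneg:
  assumes c: "0 < c" "\<forall>\<^sub>F r in at_top. c * r \<le> T r"
  shows "0 \<le> hyper_order n g"
  unfolding hyper_order_def
proof (rule le_Limsup)
  show "\<forall>\<^sub>F r in at_top. 0 \<le> ereal (ln (ln (T r)) / ln r)"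
    using c(2) eventually_ge_at_top[of "max 1 (exp 1 / c)"]
  proof eventually_elim
    case (elim r)
    have "exp 1 \<le> c * r" using elim(2) c(1) by (simp add: field_simps)
    then have "exp 1 \<le> T r" using elim(1) by simp
    then have "1 \<le> ln (T r)" by (subst ln_ge_iff) (auto intro: less_le_trans[OF exp_gt_zero])
    then show ?case using elim(2) by simp
  qed
qed simp

lemma (in convex_curve) growth_of_hyper_order:
  assumes c: "0 < c" "\<forall>\<^sub>F r in at_top. c * r \<le> T r"
    and b: "hyper_order n g < ereal b"
  shows "\<forall>\<^sub>F r in at_top. ln (T r) \<le> r powr b"
proof -
  have "\<forall>\<^sub>F r in at_top. ereal (ln (ln (T r)) / ln r) < ereal b"
    using b unfolding hyper_order_def by (rule Limsup_lessD)
  then show ?thesis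
    using c(2) eventually_ge_at_top[of "max 2 (exp 1 / c)"]
  proof eventually_elim
    case (elim r)
    have "exp 1 \<le> c * r" using elim(3) c(1) by (simp add: field_simps)
    then have "exp 1 \<le> T r" using elim(2) by simp
    then have 1: "1 \<le> ln (T r)" by (subst ln_ge_iff) (auto intro: less_le_trans[OF exp_gt_zero])
    have "ln (ln (T r)) < b * ln r"
      using elim(1,3) by (simp add: field_simps)
    then have "ln (ln (T r)) \<le> ln (r powr b)"
      using elim(3) by (simp add: ln_powr)
    then show ?case using 1 elim(3) by (subst (asm) ln_le_cancel_iff) auto
  qed
qed

lemma smallo_outside:
  "h \<in> o[at_top](k) \<Longrightarrow> h \<in> o[at_top_outside E](k)"
  unfolding at_top_outside_def by (rule landau_o.small.filter_mono[OF inf_le1])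

lemma eventually_outside:
  "(\<forall>\<^sub>F r in at_top_outside E. P r) \<longleftrightarrow> (\<forall>\<^sub>F r in at_top. r \<notin> E \<longrightarrow> P r)"
  by (simp add: at_top_outside_def eventually_inf_principal)

theorem theorem6p3:
  fixes q n :: nat and \<epsilon> :: real
    and g f :: "nat \<Rightarrow> real \<Rightarrow> real"
    and G :: "real \<Rightarrow> (nat \<Rightarrow> ereal) set"
    and a :: "nat \<Rightarrow> nat \<Rightarrow> ereal"
    and L :: "real \<Rightarrow> real"
  assumes "n > 0" and "q > n" and "\<epsilon> > 0"
    and "\<forall>j\<in>{0..n}. trop_entire (g j)"
    and "\<not> (\<exists>x. \<forall>j\<in>{0..n}. trop_root (g j) x)"
    and "\<not> GM_dependent n g"
    and "\<forall>k\<in>{0..q}. trop_lin_comb_of n g (\<lambda>i. a i k) (f k)"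
    and "L = (\<lambda>x. (\<Sum>k = 0..q. f k x) - trop_casoratian n f x)"
    and "reduced_representation n G g"
    and "hyper_order n g < 1"
  shows "\<exists>E h. finite_log_measure E \<and>
           h \<in> o[at_top_outside E](\<lambda>r. trop_cartan n g r /
                  r powr (1 - real_of_ereal (hyper_order n g) - \<epsilon>)) \<and>
           (\<forall>\<^sub>F r in at_top_outside E.
              (real q - real n - real (ddg n g (n + 1) q f)) * trop_cartan n g r
                \<le> trop_N r (\<lambda>x. - L x) - trop_N r L + h r)"
proof -
  interpret convex_curve n g
    using assms(4) by unfold_locales (auto intro: trop_entire_imp_convex)
  have pa: "piecewise_affine (g j)" if "j \<le> n" for j
    using assms(4) that trop_meromorphic_imp_piecewise_affine by (auto simp: trop_entire_def)
  obtain c where c: "0 < c" "\<forall>\<^sub>F r in at_top. c * r \<le> T r"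
    using T_linear_growth[OF assms(1,6)] by blast
  define s where "s = real_of_ereal (hyper_order n g)"
  have s_eq: "hyper_order n g = ereal s"
    using hyper_order_nonneg[OF c] assms(10) unfolding s_def
    by (cases "hyper_order n g") auto
  have s: "0 \<le> s" "s < 1"
    using hyper_order_nonneg[OF c] assms(10) by (auto simp: s_eq)
  \<comment> \<open>The exponents \<open>\<alpha> = 1 - s - \<delta>\<close> of the step and \<open>s + \<delta> / 2\<close> of the growth bound add up to \<open>1 - \<delta> / 2 < 1\<close>,
    and \<open>\<delta> < \<epsilon>\<close> makes an error of order \<open>T r / r powr \<alpha>\<close> negligible in the required sense.\<close>
  define \<delta> where "\<delta> = min \<epsilon> (1 - s) / 2"
  have \<delta>: "0 < \<delta>" "\<delta> < \<epsilon>" "\<delta> < 1 - s" using assms(3) s by (auto simp: \<delta>_def min_def)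
  define \<alpha> where "\<alpha> = 1 - s - \<delta>"
  have \<alpha>: "0 < \<alpha>" "\<alpha> < 1" "1 - s - \<epsilon> < \<alpha>" using \<delta> s by (auto simp: \<alpha>_def)
  have growth: "\<forall>\<^sub>F r in at_top. ln (T r) \<le> r powr (s + \<delta> / 2)"
    using \<delta> by (intro growth_of_hyper_order[OF c]) (simp add: s_eq)
  have large: "\<forall>\<^sub>F r in at_top. 1 \<le> T r"
    using c(2) eventually_ge_at_top[of "1 / c"]
  proof eventually_elim
    case (elim r)
    then show ?case using c(1) by (simp add: field_simps)
  qed
  obtain E where E: "finite_log_measure E"
    and regular: "\<forall>\<^sub>F r in at_top. r \<notin> E \<longrightarrow> T (r + r powr \<alpha>) \<le> 2 * T r"
    using doubling_outside_finite_log_measure[OF \<alpha>(1) _ _ T_continuous T_mono large growth] s \<delta>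
    by (auto simp: \<alpha>_def)
  obtain K C where K: "0 \<le> K" and main: "\<forall>\<^sub>F r in at_top. \<forall>h\<ge>real n.
           (real q - real n - real (ddg n g (n + 1) q f)) * T r
             \<le> trop_N r (\<lambda>x. - L x) - trop_N r L + K * (T (r + h) / h) + C"
    using characteristic_le_counting[OF assms(1,2) c pa _ assms(8), of "\<lambda>k i. a i k"] assms(7) by auto
  \<comment> \<open>The second summand absorbs the additive constant: as \<open>r powr \<alpha> \<le> r\<close>, linear growth gives
    \<open>1 \<le> T r / (c * r powr \<alpha>)\<close>.\<close>
  define h where "h = (\<lambda>r. (2 * K + \<bar>C\<bar> / c) * (T r / r powr \<alpha>))"
  have "h \<in> o[at_top](\<lambda>r. T r / r powr (1 - s - \<epsilon>))"
  proof (rule smalloI_tendsto)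
    have pos: "\<forall>\<^sub>F r in at_top. 0 < r \<and> 0 < T r"
      using eventually_gt_at_top[of 0] large by eventually_elim auto
    then show "\<forall>\<^sub>F r in at_top. T r / r powr (1 - s - \<epsilon>) \<noteq> 0"
      by eventually_elim auto
    have "((\<lambda>r. (2 * K + \<bar>C\<bar> / c) * r powr (1 - s - \<epsilon> - \<alpha>)) \<longlongrightarrow> (2 * K + \<bar>C\<bar> / c) * 0) at_top"
      using \<alpha> by (intro tendsto_intros tendsto_neg_powr filterlim_ident) auto
    moreover have "\<forall>\<^sub>F r in at_top. (2 * K + \<bar>C\<bar> / c) * r powr (1 - s - \<epsilon> - \<alpha>)
        = h r / (T r / r powr (1 - s - \<epsilon>))"
      using pos by eventually_elim (simp add: h_def powr_diff)
    ultimately show "((\<lambda>r. h r / (T r / r powr (1 - s - \<epsilon>))) \<longlongrightarrow> 0) at_top"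
      by (simp add: filterlim_cong)
  qed
  moreover have "\<forall>\<^sub>F r in at_top. r \<notin> E \<longrightarrow>
      (real q - real n - real (ddg n g (n + 1) q f)) * T r
        \<le> trop_N r (\<lambda>x. - L x) - trop_N r L + h r"
  proof -
    have "\<forall>\<^sub>F r::real in at_top. real n \<le> r powr \<alpha>"
      using eventually_ge_at_top[of "real n powr (1 / \<alpha>)"]
    proof eventually_elim
      case (elim r)
      then have "(real n powr (1 / \<alpha>)) powr \<alpha> \<le> r powr \<alpha>"
        using \<alpha>(1) by (intro powr_mono2) auto
      then show ?case using \<alpha>(1) assms(1) by (simp add: powr_powr)
    qed
    then show ?thesis
      using main regular c(2) eventually_ge_at_top[of "1::real"]
    proof eventually_elim
      case (elim r)
      show ?case
      proof
        assume "r \<notin> E"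
        then have T2: "T (r + r powr \<alpha>) \<le> 2 * T r" using elim(3) by blast
        have p: "0 < r powr \<alpha>" "r powr \<alpha> \<le> r"
          using elim(5) \<alpha> powr_mono[of \<alpha> 1 r] by auto
        have "K * (T (r + r powr \<alpha>) / r powr \<alpha>) \<le> K * (2 * T r / r powr \<alpha>)"
          using K T2 p by (intro mult_left_mono divide_right_mono) auto
        moreover have "C \<le> \<bar>C\<bar> / c * (T r / r powr \<alpha>)"
        proof -
          have "c * r powr \<alpha> \<le> c * r" using p(2) c(1) by simp
          then have "c * r powr \<alpha> \<le> T r" using elim(4) by simp
          then have "1 \<le> 1 / c * (T r / r powr \<alpha>)"
            using p(1) c(1) by (simp add: field_simps)
          then have "\<bar>C\<bar> * 1 \<le> \<bar>C\<bar> * (1 / c * (T r / r powr \<alpha>))"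
            by (intro mult_left_mono) auto
          then show ?thesis by simp
        qed
        moreover have "h r = K * (2 * T r / r powr \<alpha>) + \<bar>C\<bar> / c * (T r / r powr \<alpha>)"
          using p(1) c(1) by (simp add: h_def field_simps)
        ultimately show "(real q - real n - real (ddg n g (n + 1) q f)) * T r
            \<le> trop_N r (\<lambda>x. - L x) - trop_N r L + h r"
          using elim(2)[rule_format, OF elim(1)] by linarith
      qed
    qed
  qed
  ultimately show ?thesis
    using E unfolding s_def
    by (intro exI[of _ E] exI[of _ h]) (simp add: smallo_outside eventually_outside)
qed

end
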